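(* Let $\phi:\Omega\to(0,1]$ be $\mathcal{F}_T$-measurable and $\psi=1/\phi$. Suppose $\theta\in\mathcal{A}^\phi$ and $\eta=(\eta_t)_{t=0,\dots,T}$ is an adapted $\mathbb{R}^d$-valued process in $\mathcal{L}^1_\phi$ (that is, $\eta_t\in\mathcal{L}^1_\phi$ for each $t$) with $\eta_T=\theta$. Define $\xi=(\xi_0,\dots,\xi_T)$ by $\xi_t:=\eta_t-\eta_{t-1}$ with $\eta_{-1}\equiv 0$. Then $\xi\in\prod_{t=0}^{T}\mathcal{C}^\phi_t$ if and only if, for all $Z\in\mathcal{A}^{o,\psi}$, the process $M^Z=(M^Z_t)_{t=0,\dots,T}$ defined by $M^Z_t:=\eta_{t-1}\cdot Z_t$ is a supermartingale and $M^Z_T\ge\theta\cdot Z_T$.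
   Context: Let $(\Omega,\mathcal{F},(\mathcal{F}_t)_{t=0,1,\dots,T},\mathbb{P})$ be a filtered probability space and $d\ge 1$ an integer. $\mathcal{L}^0_t$ is the space of $\mathbb{R}^d$-valued $\mathcal{F}_t$-measurable random variables, and $b\mathcal{F}^+_t$ is the set of bounded non-negative real-valued $\mathcal{F}_t$-measurable random variables. For a (suitably measurable) random set $S$, $\mathcal{L}^0(S;\mathcal{F}_t)$ is the set of $\mathcal{F}_t$-measurable random variables taking values in $S$. A $d\times d$ real matrix $\Pi$ is a bid-ask matrix if $\Pi^{ij}>0$, $\Pi^{ii}=1$ and $\Pi^{ij}\Pi^{jk}\ge\Pi^{ik}$ for all $i,j,k$. A bid-ask process is an adapted $\mathbb{R}^{d\times d}$-valued process $(\pi_t)_{t=0,\dots,T}$ with each $\pi_t$ a bid-ask matrix; fix one, $\pi$. For a bid-ask matrix $\Pi$ let $K(\Pi)\subset\mathbb{R}^d$ be the convex cone spanned by the canonical basis vectors $e_i$ ($1\le i\le d$) and the vectors $\Pi^{ij}e_i-e_j$ ($1\le i,j\le d$). Put $-\mathcal{K}_t:=\mathcal{L}^0(-K(\pi_t);\mathcal{F}_t)$ and $\mathcal{A}:=(-\mathcal{K}_0)+\dots+(-\mathcal{K}_T)\subseteq\mathcal{L}^0_T$, the cone of claims attainable from zero endowment. For each $t$, $\mathcal{C}_t:=\{X\in\mathcal{L}^0_t:\ cX\in\mathcal{A}\text{ for all }c\in b\mathcal{F}^+_t\}$. $\mathcal{L}^1_\phi$ is the Lebesgue space of $\mathbb{R}^d$-valued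 $f$ with norm $\mathbb{E}[\phi|f|]<\infty$; its dual is $\mathcal{L}^\infty_\psi$, the space of those $f$ with $\operatorname{ess\,sup}\psi|f|<\infty$, with pairing $\mathbb{E}[Z\cdot X]$. Put $\mathcal{A}^\phi:=\mathcal{A}\cap\mathcal{L}^1_\phi$, $\mathcal{C}^\phi_t:=\mathcal{C}_t\cap\mathcal{L}^1_\phi$, and let $\mathcal{A}^{*,\psi}:=\{Z\in\mathcal{L}^\infty_\psi:\ \mathbb{E}[Z\cdot X]\le0\text{ for all }X\in\mathcal{A}^\phi\}$ be the polar cone of $\mathcal{A}^\phi$. A trading decomposition of $\mathcal{A}$ is an adapted sequence $(M_t)_{t=0,\dots,T}$ of random closed (convex) cones in $\mathbb{R}^d$ with $\mathcal{A}=\mathcal{L}^0(M_0;\mathcal{F}_0)+\dots+\mathcal{L}^0(M_T;\mathcal{F}_T)$; for example $M_t=-K(\pi_t)$. A consistent price process with respect to such a decomposition is an $\mathbb{R}^d$-valued martingale $Z=(Z_t)_{t=0,\dots,T}$ such that, for each $t$, $Z_t$ takes values in $M_t^*\setminus\{0\}$, where for a cone $M\subseteq\mathbb{R}^d$, $M^*=\{y\in\mathbb{R}^d:\ y\cdot x\le 0\text{ for all }x\in M\}$. A trading decomposition being given, $\mathcal{A}^{o,\psi}$ is the set of consistent price processes $Z$ with $Z_T\in\mathcal{A}^{*,\psi}$.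
   Formalization: The formal theorem additionally assumes that the cone A is closed in L^0_T (convergence in probability) and arbitrage-free (its only a.s. non-negative element is 0); without either assumption the "if" direction of the stated equivalence fails. *)

theory Defs
  imports "HOL-Probability.Probability"
begin

definition filtered_prob_space :: "'a measure \<Rightarrow> (nat \<Rightarrow> 'a measure) \<Rightarrow> nat \<Rightarrow> bool" where
  "filtered_prob_space M F T \<longleftrightarrow>
     prob_space M \<and> (\<forall>t\<le>T. subalgebra M (F t)) \<and>
     (\<forall>s t. s \<le> t \<longrightarrow> t \<le> T \<longrightarrow> sets (F s) \<subseteq> sets (F t))"

definition adapted :: "(nat \<Rightarrow> 'a measure) \<Rightarrow> nat \<Rightarrow> (nat \<Rightarrow> 'a \<Rightarrow> 'b::topological_space) \<Rightarrow> bool" where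
  "adapted F T X \<longleftrightarrow> (\<forall>t\<le>T. X t \<in> borel_measurable (F t))"

text \<open>
  Random variables are represented by functions, not by classes modulo null sets; the condition
  of taking values in a random set is imposed almost surely.
\<close>

definition L0 :: "'a measure \<Rightarrow> 'a measure \<Rightarrow> ('a \<Rightarrow> 'b set) \<Rightarrow> ('a \<Rightarrow> 'b::topological_space) set" where
  "L0 M G S = {X \<in> borel_measurable G. AE \<omega> in M. X \<omega> \<in> S \<omega>}"

definition bid_ask_matrix :: "real^'d^'d \<Rightarrow> bool" where
  "bid_ask_matrix P \<longleftrightarrow>
     (\<forall>i j. P $ i $ j > 0) \<and> (\<forall>i. P $ i $ i = 1) \<and>
     (\<forall>i j k. P $ i $ j * P $ j $ k \<ge> P $ i $ k)"

definition bid_ask_process ::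
    "'a measure \<Rightarrow> (nat \<Rightarrow> 'a measure) \<Rightarrow> nat \<Rightarrow> (nat \<Rightarrow> 'a \<Rightarrow> real^'d^'d) \<Rightarrow> bool" where
  "bid_ask_process M F T p \<longleftrightarrow>
     adapted F T p \<and> (\<forall>t\<le>T. AE \<omega> in M. bid_ask_matrix (p t \<omega>))"

definition solvency_cone :: "real^'d^'d \<Rightarrow> (real^'d) set" where
  "solvency_cone P =
     convex_cone hull (range (\<lambda>i. axis i 1) \<union>
       range (\<lambda>(i, j). P $ i $ j *\<^sub>R axis i 1 - axis j 1))"

definition sum_cone ::
    "'a measure \<Rightarrow> (nat \<Rightarrow> 'a measure) \<Rightarrow> nat \<Rightarrow> (nat \<Rightarrow> 'a \<Rightarrow> (real^'d) set) \<Rightarrow> ('a \<Rightarrow> real^'d) set" where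
  "sum_cone M F T S =
     {(\<lambda>\<omega>. \<Sum>t\<le>T. \<zeta> t \<omega>) |\<zeta>. \<forall>t\<le>T. \<zeta> t \<in> L0 M (F t) (S t)}"

definition attainable ::
    "'a measure \<Rightarrow> (nat \<Rightarrow> 'a measure) \<Rightarrow> nat \<Rightarrow> (nat \<Rightarrow> 'a \<Rightarrow> real^'d^'d) \<Rightarrow> ('a \<Rightarrow> real^'d) set" where
  "attainable M F T p = sum_cone M F T (\<lambda>t \<omega>. uminus ` solvency_cone (p t \<omega>))"

text \<open>Closedness in the topology of convergence in probability on the \<open>G\<close>-measurable variables.\<close>

definition closed_in_prob :: "'a measure \<Rightarrow> 'a measure \<Rightarrow> ('a \<Rightarrow> real^'d) set \<Rightarrow> bool" where
  "closed_in_prob M G A \<longleftrightarrow>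
     (\<forall>X Y. (\<forall>n::nat. X n \<in> A) \<longrightarrow> Y \<in> borel_measurable G \<longrightarrow>
        (\<forall>\<epsilon>>0. (\<lambda>n. measure M {\<omega> \<in> space M. norm (X n \<omega> - Y \<omega>) > \<epsilon>}) \<longlonglongrightarrow> 0) \<longrightarrow> Y \<in> A)"

definition arbitrage_free :: "'a measure \<Rightarrow> ('a \<Rightarrow> real^'d) set \<Rightarrow> bool" where
  "arbitrage_free M A \<longleftrightarrow>
     (\<forall>X\<in>A. (AE \<omega> in M. \<forall>i. X \<omega> $ i \<ge> 0) \<longrightarrow> (AE \<omega> in M. X \<omega> = 0))"

definition bounded_nonneg :: "'a measure \<Rightarrow> ('a \<Rightarrow> real) set" where
  "bounded_nonneg G =
     {c \<in> borel_measurable G. \<exists>B. \<forall>\<omega>\<in>space G. 0 \<le> c \<omega> \<and> c \<omega> \<le> B}"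

definition trade_cone :: "(nat \<Rightarrow> 'a measure) \<Rightarrow> ('a \<Rightarrow> real^'d) set \<Rightarrow> nat \<Rightarrow> ('a \<Rightarrow> real^'d) set" where
  "trade_cone F A t =
     {X \<in> borel_measurable (F t). \<forall>c \<in> bounded_nonneg (F t). (\<lambda>\<omega>. c \<omega> *\<^sub>R X \<omega>) \<in> A}"

definition L1_weighted :: "'a measure \<Rightarrow> 'a measure \<Rightarrow> ('a \<Rightarrow> real) \<Rightarrow> ('a \<Rightarrow> real^'d) set" where
  "L1_weighted M G \<phi> = {X \<in> borel_measurable G. integrable M (\<lambda>\<omega>. \<phi> \<omega> * norm (X \<omega>))}"

definition Linf_weighted :: "'a measure \<Rightarrow> 'a measure \<Rightarrow> ('a \<Rightarrow> real) \<Rightarrow> ('a \<Rightarrow> real^'d) set" where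
  "Linf_weighted M G \<psi> =
     {Z \<in> borel_measurable G. esssup M (\<lambda>\<omega>. ereal (\<psi> \<omega> * norm (Z \<omega>))) < \<infinity>}"

definition polar_weighted ::
    "'a measure \<Rightarrow> 'a measure \<Rightarrow> ('a \<Rightarrow> real) \<Rightarrow> ('a \<Rightarrow> real) \<Rightarrow> ('a \<Rightarrow> real^'d) set \<Rightarrow> ('a \<Rightarrow> real^'d) set" where
  "polar_weighted M G \<phi> \<psi> A =
     {Z \<in> Linf_weighted M G \<psi>.
        \<forall>X \<in> A \<inter> L1_weighted M G \<phi>. (\<integral>\<omega>. Z \<omega> \<bullet> X \<omega> \<partial>M) \<le> 0}"

definition polar :: "(real^'d) set \<Rightarrow> (real^'d) set" where
  "polar K = {y. \<forall>x\<in>K. y \<bullet> x \<le> 0}"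

text \<open>Measurability of a random closed set is meant in the sense of Effros (hitting open sets).\<close>

definition random_closed_cone :: "'a measure \<Rightarrow> ('a \<Rightarrow> (real^'d) set) \<Rightarrow> bool" where
  "random_closed_cone G K \<longleftrightarrow>
     (\<forall>\<omega>\<in>space G. closed (K \<omega>) \<and> convex_cone (K \<omega>)) \<and>
     (\<forall>U. open U \<longrightarrow> {\<omega>\<in>space G. K \<omega> \<inter> U \<noteq> {}} \<in> sets G)"

definition trading_decomposition ::
    "'a measure \<Rightarrow> (nat \<Rightarrow> 'a measure) \<Rightarrow> nat \<Rightarrow> ('a \<Rightarrow> real^'d) set \<Rightarrow> (nat \<Rightarrow> 'a \<Rightarrow> (real^'d) set) \<Rightarrow> bool" where
  "trading_decomposition M F T A K \<longleftrightarrow>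
     (\<forall>t\<le>T. random_closed_cone (F t) (K t)) \<and> A = sum_cone M F T K"

definition martingale ::
    "'a measure \<Rightarrow> (nat \<Rightarrow> 'a measure) \<Rightarrow> nat \<Rightarrow> (nat \<Rightarrow> 'a \<Rightarrow> real^'d) \<Rightarrow> bool" where
  "martingale M F T Z \<longleftrightarrow>
     adapted F T Z \<and> (\<forall>t\<le>T. integrable M (Z t)) \<and>
     (\<forall>s t i. s \<le> t \<longrightarrow> t \<le> T \<longrightarrow>
        (AE \<omega> in M. real_cond_exp M (F s) (\<lambda>\<omega>. Z t \<omega> $ i) \<omega> = Z s \<omega> $ i))"

definition supermartingale ::
    "'a measure \<Rightarrow> (nat \<Rightarrow> 'a measure) \<Rightarrow> nat \<Rightarrow> (nat \<Rightarrow> 'a \<Rightarrow> real) \<Rightarrow> bool" where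
  "supermartingale M F T Y \<longleftrightarrow>
     adapted F T Y \<and> (\<forall>t\<le>T. integrable M (Y t)) \<and>
     (\<forall>s t. s \<le> t \<longrightarrow> t \<le> T \<longrightarrow>
        (AE \<omega> in M. real_cond_exp M (F s) (Y t) \<omega> \<le> Y s \<omega>))"

definition consistent_price_process ::
    "'a measure \<Rightarrow> (nat \<Rightarrow> 'a measure) \<Rightarrow> nat \<Rightarrow> (nat \<Rightarrow> 'a \<Rightarrow> (real^'d) set) \<Rightarrow> (nat \<Rightarrow> 'a \<Rightarrow> real^'d) \<Rightarrow> bool" where
  "consistent_price_process M F T K Z \<longleftrightarrow>
     martingale M F T Z \<and> (\<forall>t\<le>T. AE \<omega> in M. Z t \<omega> \<in> polar (K t \<omega>) - {0})"

definition consistent_polar ::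
    "'a measure \<Rightarrow> (nat \<Rightarrow> 'a measure) \<Rightarrow> nat \<Rightarrow> ('a \<Rightarrow> real) \<Rightarrow> ('a \<Rightarrow> real) \<Rightarrow> ('a \<Rightarrow> real^'d) set \<Rightarrow>
     (nat \<Rightarrow> 'a \<Rightarrow> (real^'d) set) \<Rightarrow> (nat \<Rightarrow> 'a \<Rightarrow> real^'d) set" where
  "consistent_polar M F T \<phi> \<psi> A K =
     {Z. consistent_price_process M F T K Z \<and> Z T \<in> polar_weighted M (F T) \<phi> \<psi> A}"

definition lag :: "(nat \<Rightarrow> 'a \<Rightarrow> 'b::zero) \<Rightarrow> nat \<Rightarrow> 'a \<Rightarrow> 'b" where
  "lag \<eta> t = (case t of 0 \<Rightarrow> (\<lambda>_. 0) | Suc s \<Rightarrow> \<eta> s)"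

end

theory Submission
  imports Defs
begin

text \<open>
  The cone \<open>A\<close> is recovered from its dual by a direct separation argument: for \<open>X\<close> outside \<open>A\<close> the
  functional \<open>V \<mapsto> E[\<phi> sqrt(1 + |X - V|\<^sup>2)]\<close> has a minimiser \<open>V\<close> on the integrable part of \<open>A\<close>, because
  strict convexity makes a fast minimising sequence converge almost surely and \<open>A\<close> is closed in
  probability. The first-order condition at \<open>V\<close> yields a separating density dominated by \<open>\<phi>\<close>.
  Exhaustion over such densities produces a strictly positive one, and adding a small multiple of it turns
  every dual density into the terminal value of a consistent price process. Hence \<open>\<xi>\<^sub>t \<in> C\<^sub>t\<close> means exactly that
  \<open>\<xi>\<^sub>t \<bullet> Z\<^sub>t \<le> 0\<close> for all these processes, which is the one-step supermartingale inequality since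
  \<open>E[\<eta>\<^sub>t \<bullet> Z\<^bsub>t+1\<^esub> | F\<^sub>t] = \<eta>\<^sub>t \<bullet> Z\<^sub>t\<close>.
\<close>

text \<open>The linear growth of \<open>hyp\<close> is what fits it to a weighted L1 space: the
  functional is finite there, and the gradient has norm at most one, so the resulting density is
  dominated by the weight and lies in the dual space. A squared norm would be finite only under
  square integrability and would give an unbounded density. The norm itself has the right growth,
  but it is neither strictly convex nor smooth at the origin; the added coordinate 1 repairs both.
  The price is that the curvature of \<open>hyp\<close> decays at infinity, so that in the mean a
  small convexity gap controls only the square root of the distance, and the minimising sequence
  needs a fast rate.

  A consistent price process must be nonzero at every time, while a general dual density may vanish
  with positive probability. Without a strictly positive density the right-hand side of the theorem
  could be vacuous; absence of arbitrage supplies one. Positivity of a single coordinate is enough,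
  because conditional expectation preserves it.\<close>

section \<open>A strictly convex function of linear growth\<close>

text \<open>\<open>hyp x\<close> is the Euclidean norm of \<open>(1, x)\<close>.\<close>

definition hyp :: "'b::real_inner \<Rightarrow> real" where
  "hyp x = sqrt (1 + (norm x)\<^sup>2)"

lemma hyp_power2: "(hyp x)\<^sup>2 = 1 + x \<bullet> x"
  by (simp add: hyp_def power2_norm_eq_inner add_nonneg_nonneg)

lemma hyp_ge_1: "1 \<le> hyp x"
  by (simp add: hyp_def)

lemma norm_le_hyp: "norm x \<le> hyp x"
  unfolding hyp_def by (rule real_le_rsqrt) simp

lemma hyp_le: "hyp x \<le> 1 + norm x"
  unfolding hyp_def by (rule real_le_lsqrt) (auto simp: power2_sum)

text \<open>For the vectors (1, x) and (1, y) the right-hand side is the Gram determinant, the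
  defect in Cauchy-Schwarz. By Lagrange's identity it splits into the squared distance of
  \<open>x\<close> and \<open>y\<close> and the Gram determinant of \<open>x\<close> and
  \<open>y\<close>, which is non-negative.\<close>

lemma hyp_cauchy_schwarz_gap: "(norm (x - y))\<^sup>2 \<le> (hyp x * hyp y)\<^sup>2 - (1 + x \<bullet> y)\<^sup>2"
proof -
  have "(hyp x * hyp y)\<^sup>2 - (1 + x \<bullet> y)\<^sup>2
      = (norm (x - y))\<^sup>2 + ((norm x * norm y)\<^sup>2 - (x \<bullet> y)\<^sup>2)"
    by (simp add: power_mult_distrib hyp_power2 power2_norm_eq_inner inner_diff inner_commute)
       (simp add: power2_eq_square algebra_simps)
  moreover have "(x \<bullet> y)\<^sup>2 \<le> (norm x * norm y)\<^sup>2"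
    using Cauchy_Schwarz_ineq2[of x y] by (metis abs_ge_zero power2_abs power_mono)
  ultimately show ?thesis by linarith
qed

lemma one_plus_inner_le_hyp: "\<bar>1 + x \<bullet> y\<bar> \<le> hyp x * hyp y"
proof (rule power2_le_imp_le)
  show "\<bar>1 + x \<bullet> y\<bar>\<^sup>2 \<le> (hyp x * hyp y)\<^sup>2"
    using hyp_cauchy_schwarz_gap[of x y] zero_le_power2[of "norm (x - y)"]
    unfolding power2_abs by linarith
qed (use hyp_ge_1[of x] hyp_ge_1[of y] in auto)

text \<open>The gradient of \<open>hyp\<close> at \<open>x\<close> is
  \<open>x /\<^sub>R hyp x\<close>, and multiplication by \<open>hyp x\<close> turns the tangent
  inequality into Cauchy-Schwarz for (1, x) and (1, y).\<close>

lemma hyp_subgradient: "hyp x + (x /\<^sub>R hyp x) \<bullet> (y - x) \<le> hyp y"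
proof -
  have p: "0 < hyp x" using hyp_ge_1[of x] by linarith
  have "hyp x * hyp x + x \<bullet> (y - x) = 1 + x \<bullet> y"
    using hyp_power2[of x] by (simp add: power2_eq_square inner_diff)
  also have "\<dots> \<le> hyp x * hyp y" using one_plus_inner_le_hyp[of x y] by linarith
  finally show ?thesis using p by (simp add: field_simps)
qed

text \<open>Strict convexity made quantitative. Twice the value at the midpoint is the norm of (1,
  x) + (1, y), so \<open>S\<^sup>2 - m\<^sup>2\<close> is twice the Cauchy-Schwarz defect
  \<open>a - b\<close>, while the squared distance is at most \<open>a\<^sup>2 - b\<^sup>2\<close>.
  The cube of \<open>S\<close> reflects the second derivative of \<open>hyp\<close>, which on the
  line is \<open>1 / hyp x ^ 3\<close>.\<close>

lemma hyp_midpoint_gap: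
  fixes x y :: "'b::real_inner"
  defines "S \<equiv> hyp x + hyp y" and "m \<equiv> 2 * hyp ((x + y) /\<^sub>R 2)"
  shows "m \<le> S" and "(norm (x - y))\<^sup>2 \<le> (S - m) * S ^ 3"
proof -
  define a where "a = hyp x * hyp y"
  define b where "b = 1 + x \<bullet> y"
  have px: "1 \<le> hyp x" and py: "1 \<le> hyp y" by (rule hyp_ge_1)+
  have a1: "1 \<le> a" unfolding a_def using mult_mono[OF px py] px by simp
  have ab: "\<bar>b\<bar> \<le> a" unfolding a_def b_def by (rule one_plus_inner_le_hyp)
  have S2: "2 \<le> S" using px py by (simp add: S_def)
  have Sm: "S\<^sup>2 - m\<^sup>2 = 2 * (a - b)"
    unfolding S_def m_def a_def b_def power_mult_distrib power2_sum hyp_power2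
    by (simp add: inner_add inner_commute algebra_simps)
  moreover have "b \<le> a" using ab by simp
  ultimately have "m\<^sup>2 \<le> S\<^sup>2" by simp
  then show mS: "m \<le> S" by (rule power2_le_imp_le) (use S2 in linarith)
  have "(norm (x - y))\<^sup>2 \<le> a\<^sup>2 - b\<^sup>2"
    unfolding a_def b_def by (rule hyp_cauchy_schwarz_gap)
  also have "\<dots> = (a - b) * (a + b)" by (simp add: power2_eq_square algebra_simps)
  also have "\<dots> \<le> (a - b) * (2 * a)" using ab by (intro mult_left_mono) auto
  also have "\<dots> = (S - m) * ((S + m) * a)" proof -
    have "(a - b) * (2 * a) = (S\<^sup>2 - m\<^sup>2) * a" using Sm by simp
    then show ?thesis by (simp add: power2_eq_square algebra_simps)
  qed
  \<comment> \<open>\<open>S + m\<close> is at most \<open>2 * S\<close>, and the product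
    \<open>a\<close> is bounded by the arithmetic-geometric mean inequality.\<close>
  also have "\<dots> \<le> (S - m) * ((2 * S) * (S\<^sup>2 / 4))"
  proof (intro mult_left_mono mult_mono)
    have "0 \<le> (hyp x - hyp y)\<^sup>2" by simp
    then show "a \<le> S\<^sup>2 / 4" unfolding a_def S_def by (simp add: power2_eq_square algebra_simps)
  qed (use mS S2 a1 in auto)
  also have "\<dots> = (S - m) * (S ^ 3 / 2)" by (simp add: power3_eq_cube power2_eq_square)
  also have "\<dots> \<le> (S - m) * S ^ 3" using mS S2 by (intro mult_left_mono) auto
  finally show "(norm (x - y))\<^sup>2 \<le> (S - m) * S ^ 3" .
qed

text \<open>The hypothesis bounds \<open>sqrt d\<close> by the geometric mean of \<open>g\<close>
  and \<open>h\<close> with exponents 1/4 and 3/4. Rescaling by \<open>s\<close> and passing to a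
  sum, in the manner of Young's inequality, makes the bound linear in \<open>g\<close> and
  \<open>h\<close>, so that it can be integrated; \<open>s\<close> stays free to trade one term
  against the other.\<close>

lemma sqrt_le_of_power2_le:
  fixes d g h s :: real
  assumes "d\<^sup>2 \<le> g * h ^ 3" "0 \<le> d" "0 \<le> g" "0 \<le> h" "0 < s"
  shows "sqrt d \<le> s * h + g / s ^ 3"
proof -
  define z where "z = s * h + g / s ^ 3"
  have z: "s * h \<le> z" "g / s ^ 3 \<le> z" "0 \<le> z"
    using assms by (auto simp: z_def)
  have "g * h ^ 3 = (g / s ^ 3) * (s * h) ^ 3" using assms by (simp add: power_mult_distrib)
  also have "\<dots> \<le> z * z ^ 3" using z assms by (intro mult_mono power_mono) auto
  also have "\<dots> = (z\<^sup>2)\<^sup>2" by (simp add: power2_eq_square power3_eq_cube algebra_simps)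
  finally have "d\<^sup>2 \<le> (z\<^sup>2)\<^sup>2" using assms by linarith
  then have "d \<le> z\<^sup>2" by (rule power2_le_imp_le) auto
  then show ?thesis unfolding z_def[symmetric] using z by (intro real_le_lsqrt) (auto simp: assms)
qed

text \<open>With \<open>s = 2\<^sup>-\<^sup>k\<close> the bound is summable along a sequence whose convexity gap is of order \<open>16\<^sup>-\<^sup>k\<close>.\<close>

lemma hyp_cauchy_bound:
  fixes x y :: "'b::real_inner"
  assumes "0 < s"
  shows "sqrt (norm (x - y)) \<le> s * (hyp x + hyp y) +
    (hyp x + hyp y - 2 * hyp ((x + y) /\<^sub>R 2)) / s ^ 3"
  by (rule sqrt_le_of_power2_le)
     (use hyp_midpoint_gap[of x y] hyp_ge_1[of x] hyp_ge_1[of y] assms in auto)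

section \<open>Separation in weighted \<open>L\<^sup>1\<close>\<close>

lemma continuous_hyp: "isCont hyp (x :: 'b::real_inner)"
  unfolding hyp_def by (intro continuous_intros)

lemma borel_measurable_hyp[measurable]: "hyp \<in> borel_measurable (borel :: 'b::real_inner measure)"
  by (intro borel_measurable_continuous_onI continuous_at_imp_continuous_on ballI continuous_hyp)

text \<open>On a finite measure space almost sure convergence implies convergence in probability, by
  dominated convergence for the indicators of the deviation events.\<close>

lemma (in finite_measure) closed_in_prob_AE_limit:
  fixes X :: "nat \<Rightarrow> 'a \<Rightarrow> real^'d"
  assumes cl: "closed_in_prob M G A" and XA: "\<And>n. X n \<in> A"
    and [measurable]: "\<And>n. X n \<in> borel_measurable M" "Y \<in> borel_measurable M"
    and YG: "Y \<in> borel_measurable G"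
    and lim: "AE \<omega> in M. (\<lambda>n. X n \<omega>) \<longlonglongrightarrow> Y \<omega>"
  shows "Y \<in> A"
proof -
  have "(\<lambda>n. measure M {\<omega> \<in> space M. norm (X n \<omega> - Y \<omega>) > e}) \<longlonglongrightarrow> 0" if e: "e > 0" for e
  proof -
    have "(\<lambda>n. \<integral>\<omega>. indicat_real {\<omega> \<in> space M. norm (X n \<omega> - Y \<omega>) > e} \<omega> \<partial>M)
        \<longlonglongrightarrow> (\<integral>\<omega>. 0 \<partial>M)"
    proof (rule integral_dominated_convergence[where w = "\<lambda>_. 1"])
      show "AE \<omega> in M. (\<lambda>n. indicat_real {\<omega> \<in> space M. norm (X n \<omega> - Y \<omega>) > e} \<omega>) \<longlonglongrightarrow> 0"
        using lim
      proof eventually_elim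
        case (elim \<omega>)
        then have "eventually (\<lambda>n. dist (X n \<omega>) (Y \<omega>) < e) sequentially"
          using e by (rule tendstoD)
        then have "eventually (\<lambda>n. indicat_real {\<omega> \<in> space M. norm (X n \<omega> - Y \<omega>) > e} \<omega> = 0) sequentially"
          by eventually_elim (auto simp: dist_norm indicator_def)
        then show ?case by (rule tendsto_eventually)
      qed
    qed (auto simp: indicator_def)
    then show ?thesis by simp
  qed
  then show ?thesis using cl XA YG unfolding closed_in_prob_def by blast
qed

text \<open>Applied to a constant sequence, closedness makes \<open>A\<close> stable under
  measurable changes on null sets. This matters because random variables are functions here and not
  classes.\<close>

lemma (in finite_measure) closed_in_prob_AE_cong:
  fixes X :: "'a \<Rightarrow> real^'d"
  assumes "closed_in_prob M G A" "X \<in> A" "X \<in> borel_measurable M" "Y \<in> borel_measurable M"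
    "Y \<in> borel_measurable G" "AE \<omega> in M. X \<omega> = Y \<omega>"
  shows "Y \<in> A"
  by (rule closed_in_prob_AE_limit[where X = "\<lambda>_. X", OF assms(1)]) (use assms in auto)

section \<open>Weighted integrability and the functional to be minimised\<close>

locale weighted_prob_space = prob_space M for M :: "'a measure" +
  fixes G :: "'a measure" and \<phi> :: "'a \<Rightarrow> real"
  assumes subalg: "subalgebra M G"
    and weight_measurable: "\<phi> \<in> borel_measurable G"
    and weight_pos: "\<omega> \<in> space M \<Longrightarrow> 0 < \<phi> \<omega>"
    and weight_le_1: "\<omega> \<in> space M \<Longrightarrow> \<phi> \<omega> \<le> 1"
begin

lemma weight_measurable_M[measurable]: "\<phi> \<in> borel_measurable M"
  using measurable_from_subalg[OF subalg weight_measurable] .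

abbreviation L1w :: "('a \<Rightarrow> real^'d) set" where
  "L1w \<equiv> L1_weighted M G \<phi>"

lemma L1w_measurable_M: "X \<in> L1w \<Longrightarrow> X \<in> borel_measurable M"
  using measurable_from_subalg[OF subalg] by (auto simp: L1_weighted_def)

text \<open>Two dominating functions cover both later uses: sums, and products with a bounded
  factor, where the second one is zero.\<close>

lemma L1w_bounded:
  assumes "X \<in> L1w" "Y \<in> L1w" "V \<in> borel_measurable G"
    and "AE \<omega> in M. norm (V \<omega>) \<le> norm (X \<omega>) + norm (Y \<omega>)"
  shows "V \<in> L1w"
proof -
  have [measurable]: "V \<in> borel_measurable M"
    using measurable_from_subalg[OF subalg] assms(3) by auto
  have "integrable M (\<lambda>\<omega>. \<phi> \<omega> * norm (V \<omega>))"
  proof (rule Bochner_Integration.integrable_bound)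
    show "integrable M (\<lambda>\<omega>. \<phi> \<omega> * norm (X \<omega>) + \<phi> \<omega> * norm (Y \<omega>))"
      using assms by (auto simp: L1_weighted_def)
    show "AE \<omega> in M. norm (\<phi> \<omega> * norm (V \<omega>)) \<le> norm (\<phi> \<omega> * norm (X \<omega>) + \<phi> \<omega> * norm (Y \<omega>))"
      using assms(4) AE_space
    proof eventually_elim
      case (elim \<omega>)
      then show ?case
        using weight_pos[of \<omega>] mult_left_mono[OF elim(1), of "\<phi> \<omega>"]
        by (simp add: distrib_left abs_mult)
    qed
  qed measurable
  then show ?thesis using assms(3) by (simp add: L1_weighted_def)
qed

lemma L1w_scaleR: "X \<in> L1w \<Longrightarrow> (\<lambda>\<omega>. c *\<^sub>R X \<omega>) \<in> L1w"
  by (auto simp: L1_weighted_def mult.left_commute[of _ "\<bar>c\<bar>"])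

lemma L1w_add: 
  assumes X: "X \<in> L1w" and Y: "Y \<in> L1w" shows "(\<lambda>\<omega>. X \<omega> + Y \<omega>) \<in> L1w"
  by (rule L1w_bounded[OF X Y]) (use X Y norm_triangle_ineq in \<open>auto simp: L1_weighted_def\<close>)

lemma L1w_diff: 
  assumes X: "X \<in> L1w" and Y: "Y \<in> L1w" shows "(\<lambda>\<omega>. X \<omega> - Y \<omega>) \<in> L1w"
  using L1w_add[OF X L1w_scaleR[OF Y, of "-1"]] by simp

lemma weight_hyp_nonneg: "\<omega> \<in> space M \<Longrightarrow> 0 \<le> \<phi> \<omega> * hyp x"
  using weight_pos[of \<omega>] hyp_ge_1[of x] by simp

lemma integrable_weight_hyp:
  assumes X: "X \<in> L1w" shows "integrable M (\<lambda>\<omega>. \<phi> \<omega> * hyp (X \<omega>))"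
proof (rule Bochner_Integration.integrable_bound)
  have [measurable]: "X \<in> borel_measurable M" by (rule L1w_measurable_M[OF X])
  show "integrable M (\<lambda>\<omega>. 1 + \<phi> \<omega> * norm (X \<omega>))"
    using X by (auto simp: L1_weighted_def)
  show "AE \<omega> in M. norm (\<phi> \<omega> * hyp (X \<omega>)) \<le> norm (1 + \<phi> \<omega> * norm (X \<omega>))"
  proof (rule AE_I2)
    fix \<omega> assume "\<omega> \<in> space M"
    then have p: "0 < \<phi> \<omega>" "\<phi> \<omega> \<le> 1" using weight_pos weight_le_1 by auto
    have "\<phi> \<omega> * hyp (X \<omega>) \<le> \<phi> \<omega> * (1 + norm (X \<omega>))"
      using hyp_le p by (intro mult_left_mono) auto
    then have "\<phi> \<omega> * hyp (X \<omega>) \<le> 1 + \<phi> \<omega> * norm (X \<omega>)"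
      using p by (simp add: distrib_left)
    moreover have "0 \<le> \<phi> \<omega> * hyp (X \<omega>)" using hyp_ge_1[of "X \<omega>"] p by simp
    ultimately show "norm (\<phi> \<omega> * hyp (X \<omega>)) \<le> norm (1 + \<phi> \<omega> * norm (X \<omega>))" by simp
  qed
  show "(\<lambda>\<omega>. \<phi> \<omega> * hyp (X \<omega>)) \<in> borel_measurable M" by measurable
qed

text \<open>By \<open>hyp_cauchy_bound\<close> the weighted square root of an increment is bounded
  by a function whose integral is of order \<open>(1/2)^k\<close>, so these square roots are almost
  surely summable. Summable square roots force summable norms, and the sequence itself converges,
  without passing to subsequences or convex combinations.\<close>

lemma hyp_minimizing_sequence_converges:
  fixes V :: "nat \<Rightarrow> 'a \<Rightarrow> real^'d"
  assumes V: "\<And>k. V k \<in> L1w" and X: "X \<in> L1w"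
    and up: "\<And>k. (\<integral>\<omega>. \<phi> \<omega> * hyp (X \<omega> - V k \<omega>) \<partial>M) \<le> I + (1/16)^k"
    and low: "\<And>k. I \<le> (\<integral>\<omega>. \<phi> \<omega> * hyp (X \<omega> - (V k \<omega> + V (Suc k) \<omega>) /\<^sub>R 2) \<partial>M)"
  shows "AE \<omega> in M. convergent (\<lambda>k. V k \<omega>)"
proof -
  have [measurable]: "V k \<in> borel_measurable M" "X \<in> borel_measurable M" for k
    using L1w_measurable_M V X by auto
  define h where "h k \<omega> = \<phi> \<omega> * hyp (X \<omega> - V k \<omega>)" for k \<omega>
  define m where "m k \<omega> = \<phi> \<omega> * hyp (X \<omega> - (V k \<omega> + V (Suc k) \<omega>) /\<^sub>R 2)" for k \<omega>
  define f where "f k \<omega> = \<phi> \<omega> * sqrt (norm (V k \<omega> - V (Suc k) \<omega>))" for k \<omega>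
  \<comment> \<open>The bound of \<open>hyp_cauchy_bound\<close> for \<open>s = (1/2)^k\<close>,
    weighted by \<open>\<phi>\<close>; the factor \<open>8^k\<close> is
    \<open>1 / s ^ 3\<close>.\<close>
  define g where "g k \<omega> = (1/2)^k * (h k \<omega> + h (Suc k) \<omega>) + 8^k * (h k \<omega> + h (Suc k) \<omega> - 2 * m k \<omega>)" for k \<omega>
  have ih: "integrable M (h k)" for k
    unfolding h_def by (intro integrable_weight_hyp L1w_diff X V)
  have im: "integrable M (m k)" for k
    unfolding m_def by (intro integrable_weight_hyp L1w_diff X L1w_scaleR L1w_add V)
  have ig: "integrable M (g k)" for k
    unfolding g_def using ih im by auto
  have f0: "0 \<le> f k \<omega>" if "\<omega> \<in> space M" for k \<omega>
    unfolding f_def using weight_pos[OF that] by simp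
  have fg: "f k \<omega> \<le> g k \<omega>" if "\<omega> \<in> space M" for k \<omega>
  proof -
    have "sqrt (norm (V k \<omega> - V (Suc k) \<omega>)) = sqrt (norm ((X \<omega> - V k \<omega>) - (X \<omega> - V (Suc k) \<omega>)))"
      by (simp add: norm_minus_commute)
    also have "\<dots> \<le> (1/2)^k * (hyp (X \<omega> - V k \<omega>) + hyp (X \<omega> - V (Suc k) \<omega>)) +
      (hyp (X \<omega> - V k \<omega>) + hyp (X \<omega> - V (Suc k) \<omega>)
        - 2 * hyp (((X \<omega> - V k \<omega>) + (X \<omega> - V (Suc k) \<omega>)) /\<^sub>R 2)) / ((1/2)^k) ^ 3"
      by (rule hyp_cauchy_bound) simp
    also have "((X \<omega> - V k \<omega>) + (X \<omega> - V (Suc k) \<omega>)) /\<^sub>R 2 = X \<omega> - (V k \<omega> + V (Suc k) \<omega>) /\<^sub>R 2"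
      by (simp add: vec_eq_iff field_simps)
    also have "((1/2::real)^k) ^ 3 = 1 / 8^k"
      by (simp add: power_mult[symmetric] mult.commute[of k] power_mult power_one_over)
    finally have "sqrt (norm (V k \<omega> - V (Suc k) \<omega>))
      \<le> (1/2)^k * (hyp (X \<omega> - V k \<omega>) + hyp (X \<omega> - V (Suc k) \<omega>)) +
      8^k * (hyp (X \<omega> - V k \<omega>) + hyp (X \<omega> - V (Suc k) \<omega>)
        - 2 * hyp (X \<omega> - (V k \<omega> + V (Suc k) \<omega>) /\<^sub>R 2))"
      by (simp add: mult.commute)
    from mult_left_mono[OF this, of "\<phi> \<omega>"] weight_pos[OF that]
    show ?thesis by (simp add: f_def g_def h_def m_def algebra_simps)
  qed
  \<comment> \<open>Each value of the functional along the sequence is at most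
    \<open>\<bar>I\<bar> + 1\<close>, which gives \<open>2 * \<bar>I\<bar> + 2\<close>. The gap is
    at most \<open>2 * (1/16)^k\<close>, and the factor \<open>8^k\<close> turns it into the
    remaining \<open>2 * (1/2)^k\<close>.\<close>
  have gint: "(\<integral>\<omega>. g k \<omega> \<partial>M) \<le> (2 * \<bar>I\<bar> + 4) * (1/2)^k" for k
  proof -
    define a where "a = integral\<^sup>L M (h k)"
    define b where "b = integral\<^sup>L M (h (Suc k))"
    define c where "c = integral\<^sup>L M (m k)"
    have "(\<integral>\<omega>. g k \<omega> \<partial>M) = (1/2)^k * (a + b) + 8^k * (a + b - 2 * c)"
      unfolding g_def a_def b_def c_def using ih im by simp
    moreover have ak: "a \<le> I + (1/16)^k" using up[of k] unfolding a_def h_def .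
    moreover have bk: "b \<le> I + (1/16)^k"
    proof -
      have "(1/16::real)^Suc k \<le> (1/16)^k" by (rule power_decreasing) auto
      then show ?thesis using up[of "Suc k"] unfolding b_def h_def by linarith
    qed
    moreover have "I \<le> c" using low[of k] unfolding c_def m_def .
    moreover have "(1/16::real)^k \<le> 1" by (simp add: power_le_one)
    ultimately have "(\<integral>\<omega>. g k \<omega> \<partial>M) = (1/2)^k * (a + b) + 8^k * (a + b - 2 * c)"
      and "a + b \<le> 2 * \<bar>I\<bar> + 2" and "a + b - 2 * c \<le> 2 * (1/16)^k"
      by linarith+
    then have "(\<integral>\<omega>. g k \<omega> \<partial>M) \<le> (1/2)^k * (2 * \<bar>I\<bar> + 2) + 8^k * (2 * (1/16)^k)"
      by (auto intro!: add_mono mult_left_mono)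
    also have "(8::real)^k * (2 * (1/16)^k) = 2 * (1/2)^k"
      by (simp flip: power_mult_distrib add: mult.left_commute[of "8^k"])
    finally show ?thesis by (simp add: algebra_simps)
  qed
  have [measurable]: "f k \<in> borel_measurable M" for k unfolding f_def by measurable
  have "(\<integral>\<^sup>+\<omega>. (\<Sum>k. ennreal (f k \<omega>)) \<partial>M) = (\<Sum>k. \<integral>\<^sup>+\<omega>. ennreal (f k \<omega>) \<partial>M)"
    by (rule nn_integral_suminf) measurable
  also have "\<dots> \<le> (\<Sum>k. ennreal ((2 * \<bar>I\<bar> + 4) * (1/2)^k))"
  proof (rule suminf_le)
    fix k
    have "(\<integral>\<^sup>+\<omega>. ennreal (f k \<omega>) \<partial>M) \<le> (\<integral>\<^sup>+\<omega>. ennreal (g k \<omega>) \<partial>M)"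
      by (intro nn_integral_mono ennreal_leI fg)
    also have "\<dots> = ennreal (\<integral>\<omega>. g k \<omega> \<partial>M)"
      by (intro nn_integral_eq_integral ig AE_I2) (use f0 fg order_trans in blast)
    also have "\<dots> \<le> ennreal ((2 * \<bar>I\<bar> + 4) * (1/2)^k)" by (rule ennreal_leI[OF gint])
    finally show "(\<integral>\<^sup>+\<omega>. ennreal (f k \<omega>) \<partial>M) \<le> ennreal ((2 * \<bar>I\<bar> + 4) * (1/2)^k)" .
  qed auto
  also have "\<dots> = ennreal (\<Sum>k. (2 * \<bar>I\<bar> + 4) * (1/2)^k)"
    by (intro suminf_ennreal2 summable_mult summable_geometric) auto
  also have "\<dots> < \<infinity>" by simp
  finally have "AE \<omega> in M. (\<Sum>k. ennreal (f k \<omega>)) \<noteq> \<infinity>"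
    by (intro nn_integral_noteq_infinite) auto
  then show ?thesis
    using AE_space
  proof eventually_elim
    case (elim \<omega>)
    let ?D = "\<lambda>k. V (Suc k) \<omega> - V k \<omega>"
    have "summable (\<lambda>k. f k \<omega>)"
      using elim f0 by (intro summable_suminf_not_top) auto
    then have "summable (\<lambda>k. inverse (\<phi> \<omega>) * f k \<omega>)" by (rule summable_mult)
    then have s: "summable (\<lambda>k. sqrt (norm (?D k)))"
      using weight_pos[OF elim(2)] by (simp add: f_def norm_minus_commute field_simps)
    \<comment> \<open>As their terms tend to zero, the square roots are eventually below one, and
      then each norm is at most its square root.\<close>
    have "summable (\<lambda>k. norm (?D k))"
    proof (rule summable_comparison_test_ev[OF _ s])
      have "eventually (\<lambda>k. sqrt (norm (?D k)) < 1) sequentially"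
        using summable_LIMSEQ_zero[OF s] by (rule order_tendstoD) simp
      then show "eventually (\<lambda>k. norm (norm (?D k)) \<le> sqrt (norm (?D k))) sequentially"
      proof eventually_elim
        case (elim k)
        then have "sqrt (norm (?D k)) * sqrt (norm (?D k)) \<le> 1 * sqrt (norm (?D k))"
          by (intro mult_right_mono) auto
        then show ?case by simp
      qed
    qed
    then have "summable ?D" by (rule summable_norm_cancel)
    then have "(\<lambda>n. \<Sum>k<n. ?D k) \<longlonglongrightarrow> suminf ?D" by (rule summable_LIMSEQ)
    then have "(\<lambda>n. V n \<omega> - V 0 \<omega>) \<longlonglongrightarrow> suminf ?D"
      unfolding sum_lessThan_telescope[of "\<lambda>k. V k \<omega>"] .
    from tendsto_add[OF this tendsto_const[of "V 0 \<omega>"]]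
    show ?case by (auto intro: convergentI)
  qed
qed

text \<open>The direct method, with almost sure convergence in place of weak compactness. Midpoints
  stay in \<open>A\<close>, so the infimum bounds their values from below, as
  \<open>hyp_minimizing_sequence_converges\<close> requires; Fatou's lemma then transfers the
  infimum to the limit.\<close>

lemma hyp_minimizer_exists:
  fixes A :: "('a \<Rightarrow> real^'d) set"
  assumes cl: "closed_in_prob M G A" and AG: "A \<subseteq> borel_measurable G"
    and ne: "A \<inter> L1w \<noteq> {}"
    and mid: "\<And>V W. V \<in> A \<Longrightarrow> W \<in> A \<Longrightarrow> (\<lambda>\<omega>. (V \<omega> + W \<omega>) /\<^sub>R 2) \<in> A"
    and X: "X \<in> L1w"
  obtains V where "V \<in> A \<inter> L1w"
    "\<And>W. W \<in> A \<inter> L1w \<Longrightarrow>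
      (\<integral>\<omega>. \<phi> \<omega> * hyp (X \<omega> - V \<omega>) \<partial>M) \<le> (\<integral>\<omega>. \<phi> \<omega> * hyp (X \<omega> - W \<omega>) \<partial>M)"
proof -
  define J where "J W = (\<integral>\<omega>. \<phi> \<omega> * hyp (X \<omega> - W \<omega>) \<partial>M)" for W
  define I where "I = Inf (J ` (A \<inter> L1w))"
  have J0: "0 \<le> J W" for W
    unfolding J_def
    by (intro integral_nonneg_AE AE_I2 weight_hyp_nonneg)
  then have bdd: "bdd_below (J ` (A \<inter> L1w))" by (intro bdd_belowI[of _ 0]) auto
  have IJ: "I \<le> J W" if "W \<in> A \<inter> L1w" for W
    unfolding I_def using that bdd by (intro cInf_lower) auto
  have I0: "0 \<le> I" unfolding I_def using ne J0 by (intro cInf_greatest) auto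
  have "\<exists>W\<in>A \<inter> L1w. J W < I + (1/16)^k" for k :: nat
  proof -
    have "Inf (J ` (A \<inter> L1w)) < I + (1/16)^k" by (simp add: I_def)
    then show ?thesis using cInf_lessD[of "J ` (A \<inter> L1w)"] ne by fastforce
  qed
  then obtain V where VA: "\<And>k. V k \<in> A \<inter> L1w" and VJ: "\<And>k. J (V k) < I + (1/16)^k" by metis
  have VG[measurable]: "V k \<in> borel_measurable G" for k using VA AG by auto
  have [measurable]: "V k \<in> borel_measurable M" "X \<in> borel_measurable M" for k
    using L1w_measurable_M VA X by auto
  \<comment> \<open>\<open>lim\<close> is defined at every point, so \<open>U\<close> is measurable
    for \<open>G\<close> itself and not just up to null sets.\<close>
  define U where "U \<omega> = lim (\<lambda>k. V k \<omega>)" for \<omega>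
  have UG: "U \<in> borel_measurable G" unfolding U_def by measurable
  have [measurable]: "U \<in> borel_measurable M" unfolding U_def by measurable
  have conv: "AE \<omega> in M. (\<lambda>k. V k \<omega>) \<longlonglongrightarrow> U \<omega>"
  proof -
    have "AE \<omega> in M. convergent (\<lambda>k. V k \<omega>)"
    proof (rule hyp_minimizing_sequence_converges[OF _ X, where I = I])
      fix k
      show "V k \<in> L1w" using VA by auto
      show "(\<integral>\<omega>. \<phi> \<omega> * hyp (X \<omega> - V k \<omega>) \<partial>M) \<le> I + (1/16)^k"
        using VJ[of k] unfolding J_def by linarith
      show "I \<le> (\<integral>\<omega>. \<phi> \<omega> * hyp (X \<omega> - (V k \<omega> + V (Suc k) \<omega>) /\<^sub>R 2) \<partial>M)"
        using IJ[of "\<lambda>\<omega>. (V k \<omega> + V (Suc k) \<omega>) /\<^sub>R 2"] mid VA L1w_scaleR[OF L1w_add]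
        unfolding J_def by blast
    qed
    then show ?thesis unfolding U_def convergent_LIMSEQ_iff .
  qed
  have UA: "U \<in> A"
    by (rule closed_in_prob_AE_limit[OF cl, of V]) (use VA UG conv in auto)
  have "(\<integral>\<^sup>+\<omega>. ennreal (\<phi> \<omega> * hyp (X \<omega> - U \<omega>)) \<partial>M)
      = (\<integral>\<^sup>+\<omega>. liminf (\<lambda>k. ennreal (\<phi> \<omega> * hyp (X \<omega> - V k \<omega>))) \<partial>M)"
  proof (rule nn_integral_cong_AE, use conv in eventually_elim)
    case (elim \<omega>)
    have "(\<lambda>k. ennreal (\<phi> \<omega> * hyp (X \<omega> - V k \<omega>))) \<longlonglongrightarrow> ennreal (\<phi> \<omega> * hyp (X \<omega> - U \<omega>))"
      by (intro tendsto_ennrealI tendsto_intros isCont_tendsto_compose[OF continuous_hyp] elim)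
    then show ?case by (simp add: lim_imp_Liminf)
  qed
  also have "\<dots> \<le> liminf (\<lambda>k. \<integral>\<^sup>+\<omega>. ennreal (\<phi> \<omega> * hyp (X \<omega> - V k \<omega>)) \<partial>M)"
    by (rule nn_integral_liminf) measurable
  also have "\<dots> = liminf (\<lambda>k. ennreal (J (V k)))"
  proof -
    have "(\<integral>\<^sup>+\<omega>. ennreal (\<phi> \<omega> * hyp (X \<omega> - V k \<omega>)) \<partial>M) = ennreal (J (V k))" for k
      unfolding J_def
      by (intro nn_integral_eq_integral integrable_weight_hyp L1w_diff X AE_I2 weight_hyp_nonneg)
         (use VA in auto)
    then show ?thesis by simp
  qed
  also have "\<dots> = ennreal I"
  proof -
    have "(\<lambda>k. J (V k)) \<longlonglongrightarrow> I"
    proof (rule tendsto_sandwich[where f = "\<lambda>_. I" and h = "\<lambda>k. I + (1/16)^k"])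
      show "(\<lambda>k. I + (1/16)^k) \<longlonglongrightarrow> I"
        using tendsto_add[OF tendsto_const[of I] LIMSEQ_realpow_zero[of "1/16"]] by simp
    qed (use IJ VA less_imp_le[OF VJ] in \<open>auto intro!: always_eventually\<close>)
    then show ?thesis by (intro lim_imp_Liminf tendsto_ennrealI) auto
  qed
  finally have fin: "(\<integral>\<^sup>+\<omega>. ennreal (\<phi> \<omega> * hyp (X \<omega> - U \<omega>)) \<partial>M) \<le> ennreal I" .
  have int: "integrable M (\<lambda>\<omega>. \<phi> \<omega> * hyp (X \<omega> - U \<omega>))"
    using fin weight_hyp_nonneg by (intro integrableI_nonneg) (auto simp: le_less_trans[OF _ ennreal_less_top])
  have JU: "J U \<le> I"
    using fin nn_integral_eq_integral[OF int AE_I2[OF weight_hyp_nonneg]] I0 unfolding J_def by simp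
  \<comment> \<open>Closedness in probability says nothing about integrability of the limit; it
    comes from the finite value of the functional, since \<open>hyp\<close> dominates the
    norm.\<close>
  have "integrable M (\<lambda>\<omega>. \<phi> \<omega> * norm (U \<omega>))"
  proof (rule Bochner_Integration.integrable_bound)
    show "integrable M (\<lambda>\<omega>. \<phi> \<omega> * norm (X \<omega>) + \<phi> \<omega> * hyp (X \<omega> - U \<omega>))"
      using int X by (auto simp: L1_weighted_def)
    show "AE \<omega> in M. norm (\<phi> \<omega> * norm (U \<omega>)) \<le> norm (\<phi> \<omega> * norm (X \<omega>) + \<phi> \<omega> * hyp (X \<omega> - U \<omega>))"
    proof (rule AE_I2)
      fix \<omega> assume w: "\<omega> \<in> space M"
      have "norm (U \<omega>) \<le> norm (X \<omega>) + hyp (X \<omega> - U \<omega>)"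
        using norm_triangle_ineq4[of "X \<omega>" "X \<omega> - U \<omega>"] norm_le_hyp[of "X \<omega> - U \<omega>"] by simp
      from mult_left_mono[OF this, of "\<phi> \<omega>"] weight_pos[OF w]
      show "norm (\<phi> \<omega> * norm (U \<omega>)) \<le> norm (\<phi> \<omega> * norm (X \<omega>) + \<phi> \<omega> * hyp (X \<omega> - U \<omega>))"
        by (simp add: distrib_left abs_mult)
    qed
  qed measurable
  then have "U \<in> A \<inter> L1w" using UA UG by (simp add: L1_weighted_def)
  moreover have "J U \<le> J W" if "W \<in> A \<inter> L1w" for W using JU IJ[OF that] by linarith
  ultimately show thesis using that unfolding J_def by blast
qed

text \<open>Instead of differentiating under the integral, the proof uses the subgradient inequality
  at the shifted point \<open>U - t *\<^sub>R V\<close> towards \<open>U\<close>. Minimality makes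
  the pairing of \<open>V\<close> with the gradient at the shifted point non-positive for
  \<open>t\<close> in (0, 1], and dominated convergence lets \<open>t\<close> tend to zero.\<close>

lemma hyp_minimizer_first_order:
  fixes U V :: "'a \<Rightarrow> real^'d"
  assumes U: "U \<in> L1w" and V: "V \<in> L1w"
    and min: "\<And>t. 0 < t \<Longrightarrow> t \<le> 1 \<Longrightarrow>
      (\<integral>\<omega>. \<phi> \<omega> * hyp (U \<omega>) \<partial>M) \<le> (\<integral>\<omega>. \<phi> \<omega> * hyp (U \<omega> - t *\<^sub>R V \<omega>) \<partial>M)"
  shows "(\<integral>\<omega>. (\<phi> \<omega> / hyp (U \<omega>)) *\<^sub>R U \<omega> \<bullet> V \<omega> \<partial>M) \<le> 0"
proof -
  have [measurable]: "U \<in> borel_measurable M" "V \<in> borel_measurable M"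
    using L1w_measurable_M U V by auto
  define Z where "Z t \<omega> = (\<phi> \<omega> / hyp (U \<omega> - t *\<^sub>R V \<omega>)) *\<^sub>R (U \<omega> - t *\<^sub>R V \<omega>) \<bullet> V \<omega>" for t \<omega>
  have [measurable]: "Z t \<in> borel_measurable M" for t unfolding Z_def by measurable
  have bound: "norm (Z t \<omega>) \<le> \<phi> \<omega> * norm (V \<omega>)" if "\<omega> \<in> space M" for t \<omega>
  proof -
    let ?W = "U \<omega> - t *\<^sub>R V \<omega>"
    have h: "1 \<le> hyp ?W" "norm ?W \<le> hyp ?W" by (rule hyp_ge_1 norm_le_hyp)+
    have "norm (Z t \<omega>) \<le> norm ((\<phi> \<omega> / hyp ?W) *\<^sub>R ?W) * norm (V \<omega>)"
      unfolding Z_def by (simp only: real_norm_def Cauchy_Schwarz_ineq2)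
    also have "norm ((\<phi> \<omega> / hyp ?W) *\<^sub>R ?W) \<le> \<phi> \<omega>"
      using h weight_pos[OF that] by (simp add: divide_le_eq)
    finally show ?thesis by (simp add: mult_right_mono)
  qed
  have iV: "integrable M (\<lambda>\<omega>. \<phi> \<omega> * norm (V \<omega>))" using V by (simp add: L1_weighted_def)
  have iZ: "integrable M (Z t)" for t
    by (rule Bochner_Integration.integrable_bound[OF iV]) (auto intro!: AE_I2 order_trans[OF bound[unfolded real_norm_def]])
  have neg: "(\<integral>\<omega>. Z t \<omega> \<partial>M) \<le> 0" if t: "0 < t" "t \<le> 1" for t
  proof -
    have iU: "integrable M (\<lambda>\<omega>. \<phi> \<omega> * hyp (U \<omega>))" by (intro integrable_weight_hyp U)
    have iUt: "integrable M (\<lambda>\<omega>. \<phi> \<omega> * hyp (U \<omega> - t *\<^sub>R V \<omega>))"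
      by (intro integrable_weight_hyp L1w_diff L1w_scaleR U V)
    have "(\<integral>\<omega>. \<phi> \<omega> * hyp (U \<omega> - t *\<^sub>R V \<omega>) + t * Z t \<omega> \<partial>M) \<le> (\<integral>\<omega>. \<phi> \<omega> * hyp (U \<omega>) \<partial>M)"
    proof (rule integral_mono)
      fix \<omega> assume w: "\<omega> \<in> space M"
      let ?W = "U \<omega> - t *\<^sub>R V \<omega>"
      have "\<phi> \<omega> * (hyp ?W + (?W /\<^sub>R hyp ?W) \<bullet> (U \<omega> - ?W)) \<le> \<phi> \<omega> * hyp (U \<omega>)"
        using weight_pos[OF w] by (intro mult_left_mono hyp_subgradient) auto
      then show "\<phi> \<omega> * hyp ?W + t * Z t \<omega> \<le> \<phi> \<omega> * hyp (U \<omega>)"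
        by (simp add: Z_def distrib_left divide_inverse mult.assoc mult.left_commute)
    qed (use iU iUt iZ in auto)
    with iUt iZ have "(\<integral>\<omega>. \<phi> \<omega> * hyp (U \<omega> - t *\<^sub>R V \<omega>) \<partial>M) + t * (\<integral>\<omega>. Z t \<omega> \<partial>M)
        \<le> (\<integral>\<omega>. \<phi> \<omega> * hyp (U \<omega>) \<partial>M)" by simp
    with min[OF t] have "t * (\<integral>\<omega>. Z t \<omega> \<partial>M) \<le> 0" by linarith
    with t show ?thesis by (simp add: mult_le_0_iff)
  qed
  have "(\<lambda>n. \<integral>\<omega>. Z (1 / real (Suc n)) \<omega> \<partial>M) \<longlonglongrightarrow> (\<integral>\<omega>. Z 0 \<omega> \<partial>M)"
  proof (rule integral_dominated_convergence[OF _ _ iV])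
    show "AE \<omega> in M. (\<lambda>n. Z (1 / real (Suc n)) \<omega>) \<longlonglongrightarrow> Z 0 \<omega>"
    proof (rule AE_I2)
      fix \<omega>
      have "isCont (\<lambda>t. Z t \<omega>) 0"
        unfolding Z_def using hyp_ge_1[of "U \<omega>"]
        by (intro continuous_intros isCont_o2[OF _ continuous_hyp]) auto
      then show "(\<lambda>n. Z (1 / real (Suc n)) \<omega>) \<longlonglongrightarrow> Z 0 \<omega>"
        using isCont_tendsto_compose[of 0 "\<lambda>t. Z t \<omega>", OF _ lim_inverse_n'[THEN LIMSEQ_Suc]] by simp
    qed
    show "AE \<omega> in M. norm (Z (1 / real (Suc n)) \<omega>) \<le> \<phi> \<omega> * norm (V \<omega>)" for n
      by (rule AE_I2) (rule bound)
  qed auto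
  then have "(\<integral>\<omega>. Z 0 \<omega> \<partial>M) \<le> 0"
    by (rule LIMSEQ_le_const2) (auto intro!: exI[of _ 0] neg)
  then show ?thesis by (simp add: Z_def)
qed

end

section \<open>The polar cone and the bipolar theorem\<close>

lemma (in weighted_prob_space) Linf_weighted_iff:
  fixes Z :: "'a \<Rightarrow> real^'d"
  shows "Z \<in> Linf_weighted M G (\<lambda>\<omega>. 1 / \<phi> \<omega>) \<longleftrightarrow>
    Z \<in> borel_measurable G \<and> (\<exists>C. AE \<omega> in M. norm (Z \<omega>) \<le> C * \<phi> \<omega>)"
proof (cases "Z \<in> borel_measurable G")
  case True
  have [measurable]: "Z \<in> borel_measurable M" by (rule measurable_from_subalg[OF subalg True])
  define f where "f \<omega> = ereal (1 / \<phi> \<omega> * norm (Z \<omega>))" for \<omega>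
  have [measurable]: "f \<in> borel_measurable M" unfolding f_def by measurable
  have f_le: "f \<omega> \<le> ereal C \<longleftrightarrow> norm (Z \<omega>) \<le> C * \<phi> \<omega>" if "\<omega> \<in> space M" for \<omega> C
    using weight_pos[OF that] by (simp add: f_def pos_divide_le_eq)
  have "esssup M f < \<infinity> \<longleftrightarrow> (\<exists>C. AE \<omega> in M. f \<omega> \<le> ereal C)"
  proof
    assume "esssup M f < \<infinity>"
    then obtain C where "esssup M f \<le> ereal C"
      by (cases "esssup M f") auto
    then have "AE \<omega> in M. f \<omega> \<le> ereal C"
      using esssup_AE[of f M] by (auto elim: eventually_mono)
    then show "\<exists>C. AE \<omega> in M. f \<omega> \<le> ereal C" by blast
  next
    assume "\<exists>C. AE \<omega> in M. f \<omega> \<le> ereal C"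
    then obtain C where "AE \<omega> in M. f \<omega> \<le> ereal C" by blast
    then have "esssup M f \<le> ereal C" by (intro esssup_I) auto
    then show "esssup M f < \<infinity>" by auto
  qed
  also have "\<dots> \<longleftrightarrow> (\<exists>C. AE \<omega> in M. norm (Z \<omega>) \<le> C * \<phi> \<omega>)"
    by (intro ex_cong1 AE_cong f_le)
  finally show ?thesis using True unfolding Linf_weighted_def f_def by blast
qed (simp add: Linf_weighted_def)

text \<open>Collects what the bipolar theorem rests on, closedness and the convex cone structure;
  absence of arbitrage and free disposal join in \<open>arbitrage_free_cone\<close>.\<close>

locale claim_cone = weighted_prob_space M G \<phi> for M :: "'a measure" and G \<phi> +
  fixes A :: "('a \<Rightarrow> real^'d) set"
  assumes closed: "closed_in_prob M G A"
    and A_measurable: "A \<subseteq> borel_measurable G"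
    and zero_mem: "(\<lambda>_. 0) \<in> A"
    and add_mem: "X \<in> A \<Longrightarrow> Y \<in> A \<Longrightarrow> (\<lambda>\<omega>. X \<omega> + Y \<omega>) \<in> A"
    and scaleR_mem: "X \<in> A \<Longrightarrow> 0 \<le> c \<Longrightarrow> (\<lambda>\<omega>. c *\<^sub>R X \<omega>) \<in> A"
begin

abbreviation dual :: "('a \<Rightarrow> real^'d) set" where
  "dual \<equiv> polar_weighted M G \<phi> (\<lambda>\<omega>. 1 / \<phi> \<omega>) A"

lemma dual_measurable: "Z \<in> dual \<Longrightarrow> Z \<in> borel_measurable G"
  by (simp add: polar_weighted_def Linf_weighted_def)

lemma dual_measurable_M: "Z \<in> dual \<Longrightarrow> Z \<in> borel_measurable M"
  using measurable_from_subalg[OF subalg dual_measurable] .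

lemma dual_bounded: "Z \<in> dual \<Longrightarrow> \<exists>C. AE \<omega> in M. norm (Z \<omega>) \<le> C * \<phi> \<omega>"
  by (simp add: polar_weighted_def Linf_weighted_iff)

lemma dualI:
  assumes "Z \<in> borel_measurable G" "AE \<omega> in M. norm (Z \<omega>) \<le> C * \<phi> \<omega>"
    "\<And>X. X \<in> A \<Longrightarrow> X \<in> L1w \<Longrightarrow> (\<integral>\<omega>. Z \<omega> \<bullet> X \<omega> \<partial>M) \<le> 0"
  shows "Z \<in> dual"
  using assms unfolding polar_weighted_def by (auto simp: Linf_weighted_iff)

lemma integrable_inner_bounded:
  fixes X :: "'a \<Rightarrow> real^'d"
  assumes [measurable]: "Z \<in> borel_measurable M" and Z: "AE \<omega> in M. norm (Z \<omega>) \<le> C * \<phi> \<omega>"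
    and X: "X \<in> L1w"
  shows "integrable M (\<lambda>\<omega>. Z \<omega> \<bullet> X \<omega>)"
proof (rule Bochner_Integration.integrable_bound)
  show "integrable M (\<lambda>\<omega>. C * (\<phi> \<omega> * norm (X \<omega>)))" using X by (simp add: L1_weighted_def)
  show "AE \<omega> in M. norm (Z \<omega> \<bullet> X \<omega>) \<le> norm (C * (\<phi> \<omega> * norm (X \<omega>)))"
    using Z
  proof eventually_elim
    case (elim \<omega>)
    have "norm (Z \<omega> \<bullet> X \<omega>) \<le> norm (Z \<omega>) * norm (X \<omega>)" by (simp add: Cauchy_Schwarz_ineq2)
    also have "\<dots> \<le> (C * \<phi> \<omega>) * norm (X \<omega>)" using elim by (intro mult_right_mono) auto
    finally show ?case by (simp add: mult.assoc)
  qed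
qed (use L1w_measurable_M[OF X] in measurable)

lemma integrable_inner: "Z \<in> dual \<Longrightarrow> X \<in> L1w \<Longrightarrow> integrable M (\<lambda>\<omega>. Z \<omega> \<bullet> X \<omega>)"
  using dual_bounded integrable_inner_bounded dual_measurable_M by blast

lemma dual_inner_le: "Z \<in> dual \<Longrightarrow> X \<in> A \<Longrightarrow> X \<in> L1w \<Longrightarrow> (\<integral>\<omega>. Z \<omega> \<bullet> X \<omega> \<partial>M) \<le> 0"
  by (auto simp: polar_weighted_def)

lemma dual_zero: "(\<lambda>_. 0) \<in> dual"
  by (rule dualI[where C = 0]) auto

lemma dual_add:
  assumes Y: "Y \<in> dual" and Z: "Z \<in> dual" shows "(\<lambda>\<omega>. Y \<omega> + Z \<omega>) \<in> dual"
proof -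
  obtain C D where "AE \<omega> in M. norm (Y \<omega>) \<le> C * \<phi> \<omega>" "AE \<omega> in M. norm (Z \<omega>) \<le> D * \<phi> \<omega>"
    using dual_bounded Y Z by blast
  then have "AE \<omega> in M. norm (Y \<omega> + Z \<omega>) \<le> (C + D) * \<phi> \<omega>"
    by eventually_elim (simp add: distrib_right norm_triangle_le)
  then show ?thesis
    using dual_measurable[OF Y] dual_measurable[OF Z] dual_inner_le[OF Y] dual_inner_le[OF Z]
      integrable_inner[OF Y] integrable_inner[OF Z]
    by (intro dualI) (auto simp: inner_add_left add_nonpos_nonpos)
qed

lemma dual_scaleR:
  assumes Z: "Z \<in> dual" and "0 \<le> c" shows "(\<lambda>\<omega>. c *\<^sub>R Z \<omega>) \<in> dual"
proof -
  obtain D where "AE \<omega> in M. norm (Z \<omega>) \<le> D * \<phi> \<omega>"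
    using dual_bounded Z by blast
  then have "AE \<omega> in M. norm (c *\<^sub>R Z \<omega>) \<le> (c * D) * \<phi> \<omega>"
    by eventually_elim (simp add: assms mult.assoc mult_left_mono)
  then show ?thesis
    using dual_measurable[OF Z] dual_inner_le[OF Z] assms
    by (intro dualI) (auto simp: mult_nonneg_nonpos)
qed

text \<open>The separating density is \<open>\<phi>\<close> times a gradient of \<open>hyp\<close>, which has norm at most one.\<close>

theorem separation:
  assumes X: "X \<in> L1w" and XA: "X \<notin> A"
  obtains Z where "Z \<in> dual" "\<And>\<omega>. \<omega> \<in> space M \<Longrightarrow> norm (Z \<omega>) \<le> \<phi> \<omega>" "0 < (\<integral>\<omega>. Z \<omega> \<bullet> X \<omega> \<partial>M)"
proof -
  have L0: "(\<lambda>_. 0 :: real^'d) \<in> L1w" by (simp add: L1_weighted_def)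
  have ne: "A \<inter> L1w \<noteq> {}" using L0 zero_mem by blast
  have mid: "(\<lambda>\<omega>. (V \<omega> + W \<omega>) /\<^sub>R 2) \<in> A" if "V \<in> A" "W \<in> A" for V W
    by (rule scaleR_mem[OF add_mem[OF that]]) simp
  obtain V where V: "V \<in> A \<inter> L1w" and Vmin: "\<And>W. W \<in> A \<inter> L1w \<Longrightarrow>
      (\<integral>\<omega>. \<phi> \<omega> * hyp (X \<omega> - V \<omega>) \<partial>M) \<le> (\<integral>\<omega>. \<phi> \<omega> * hyp (X \<omega> - W \<omega>) \<partial>M)"
    by (rule hyp_minimizer_exists[OF closed A_measurable ne mid X]) (assumption | rule that)+
  define U where "U \<omega> = X \<omega> - V \<omega>" for \<omega>
  define Z where "Z \<omega> = (\<phi> \<omega> / hyp (U \<omega>)) *\<^sub>R U \<omega>" for \<omega>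
  have U: "U \<in> L1w" unfolding U_def using L1w_diff[OF X] V by simp
  have [measurable]: "U \<in> borel_measurable M" "X \<in> borel_measurable M" "V \<in> borel_measurable M"
    using L1w_measurable_M U X V by auto
  have ZG: "Z \<in> borel_measurable G"
    unfolding Z_def using U weight_measurable by (auto simp: L1_weighted_def)
  have [measurable]: "Z \<in> borel_measurable M" by (rule measurable_from_subalg[OF subalg ZG])
  have Zb: "norm (Z \<omega>) \<le> \<phi> \<omega>" if "\<omega> \<in> space M" for \<omega>
    using norm_le_hyp[of "U \<omega>"] hyp_ge_1[of "U \<omega>"] weight_pos[OF that]
    by (simp add: Z_def divide_le_eq)
  have Zb': "AE \<omega> in M. norm (Z \<omega>) \<le> 1 * \<phi> \<omega>" using Zb by auto
  \<comment> \<open>Stated for all admissible directions because two kinds are needed: elements of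
    \<open>A\<close>, and the direction from \<open>V\<close> back to the apex of the cone.\<close>
  have foc: "(\<integral>\<omega>. Z \<omega> \<bullet> W \<omega> \<partial>M) \<le> 0"
    if W: "W \<in> L1w" and mem: "\<And>t. 0 < t \<Longrightarrow> t \<le> 1 \<Longrightarrow> (\<lambda>\<omega>. V \<omega> + t *\<^sub>R W \<omega>) \<in> A" for W
    unfolding Z_def
  proof (rule hyp_minimizer_first_order[OF U W])
    fix t :: real assume t: "0 < t" "t \<le> 1"
    have "(\<lambda>\<omega>. V \<omega> + t *\<^sub>R W \<omega>) \<in> A \<inter> L1w"
      using mem[OF t] V W L1w_add L1w_scaleR by blast
    from Vmin[OF this]
    show "(\<integral>\<omega>. \<phi> \<omega> * hyp (U \<omega>) \<partial>M) \<le> (\<integral>\<omega>. \<phi> \<omega> * hyp (U \<omega> - t *\<^sub>R W \<omega>) \<partial>M)"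
      by (simp add: U_def diff_diff_eq)
  qed
  have "Z \<in> dual"
  proof (rule dualI[OF ZG Zb'])
    fix W assume "W \<in> A" "W \<in> L1w"
    then show "(\<integral>\<omega>. Z \<omega> \<bullet> W \<omega> \<partial>M) \<le> 0"
      using V by (intro foc add_mem scaleR_mem) auto
  qed
  moreover have "0 < (\<integral>\<omega>. Z \<omega> \<bullet> X \<omega> \<partial>M)"
  proof -
    have iX: "integrable M (\<lambda>\<omega>. Z \<omega> \<bullet> X \<omega>)" and iV: "integrable M (\<lambda>\<omega>. Z \<omega> \<bullet> V \<omega>)"
      and iU: "integrable M (\<lambda>\<omega>. Z \<omega> \<bullet> U \<omega>)"
      using integrable_inner_bounded[OF _ Zb'] X V U by auto
    \<comment> \<open>Moving from \<open>V\<close> towards zero stays in the cone, as the point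
      reached is a non-negative multiple of \<open>V\<close>. Hence the pairing of \<open>Z\<close>
      with \<open>V\<close> is non-negative, and it suffices to treat \<open>U\<close>, the
      difference of \<open>X\<close> and \<open>V\<close>.\<close>
    have "(\<integral>\<omega>. Z \<omega> \<bullet> (- 1 *\<^sub>R V \<omega>) \<partial>M) \<le> 0"
    proof (rule foc)
      show "(\<lambda>\<omega>. - 1 *\<^sub>R V \<omega>) \<in> L1w" using V by (intro L1w_scaleR) auto
      fix t :: real assume "0 < t" "t \<le> 1"
      then have "(\<lambda>\<omega>. (1 - t) *\<^sub>R V \<omega>) \<in> A" using V by (intro scaleR_mem) auto
      then show "(\<lambda>\<omega>. V \<omega> + t *\<^sub>R (- 1 *\<^sub>R V \<omega>)) \<in> A" by (simp add: algebra_simps)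
    qed
    then have "0 \<le> (\<integral>\<omega>. Z \<omega> \<bullet> V \<omega> \<partial>M)" by simp
    moreover have "(\<integral>\<omega>. Z \<omega> \<bullet> X \<omega> \<partial>M) = (\<integral>\<omega>. Z \<omega> \<bullet> U \<omega> \<partial>M) + (\<integral>\<omega>. Z \<omega> \<bullet> V \<omega> \<partial>M)"
      using iU iV by (simp flip: Bochner_Integration.integral_add add: U_def inner_diff_right)
    \<comment> \<open>\<open>Z \<omega> \<bullet> U \<omega>\<close> is a positive multiple of
      \<open>U \<omega> \<bullet> U \<omega>\<close>, so a vanishing integral would mean that
      \<open>X\<close> and \<open>V\<close> agree almost surely, which would put \<open>X\<close>
      into \<open>A\<close>.\<close>
    moreover have "0 < (\<integral>\<omega>. Z \<omega> \<bullet> U \<omega> \<partial>M)"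
    proof (rule ccontr)
      have ZU: "Z \<omega> \<bullet> U \<omega> = \<phi> \<omega> / hyp (U \<omega>) * (U \<omega> \<bullet> U \<omega>)" for \<omega> by (simp add: Z_def)
      have nn: "AE \<omega> in M. 0 \<le> Z \<omega> \<bullet> U \<omega>"
      proof (rule AE_I2)
        fix \<omega> assume "\<omega> \<in> space M"
        then show "0 \<le> Z \<omega> \<bullet> U \<omega>"
          using weight_pos[of \<omega>] hyp_ge_1[of "U \<omega>"] by (simp add: ZU)
      qed
      assume "\<not> 0 < (\<integral>\<omega>. Z \<omega> \<bullet> U \<omega> \<partial>M)"
      then have "(\<integral>\<omega>. Z \<omega> \<bullet> U \<omega> \<partial>M) = 0" using integral_nonneg_AE[OF nn] by linarith
      then have "AE \<omega> in M. Z \<omega> \<bullet> U \<omega> = 0" using integral_nonneg_eq_0_iff_AE[OF iU nn] by simp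
      then have "AE \<omega> in M. V \<omega> = X \<omega>" using AE_space
      proof eventually_elim
        case (elim \<omega>)
        then have "U \<omega> = 0" using weight_pos[of \<omega>] hyp_ge_1[of "U \<omega>"] by (simp add: ZU)
        then show ?case by (simp add: U_def)
      qed
      then have "X \<in> A"
        using V X by (intro closed_in_prob_AE_cong[OF closed, of V X]) (auto simp: L1_weighted_def)
      then show False using XA by simp
    qed
    ultimately show ?thesis by linarith
  qed
  ultimately show thesis using that Zb by blast
qed

corollary bipolar:
  assumes "X \<in> L1w" "\<And>Z. Z \<in> dual \<Longrightarrow> (\<integral>\<omega>. Z \<omega> \<bullet> X \<omega> \<partial>M) \<le> 0"
  shows "X \<in> A"
  using separation[OF assms(1)] assms(2) by (metis not_less)

end

section \<open>Strictly positive dual elements\<close>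

lemma (in weighted_prob_space) bounded_imp_L1w:
  assumes X: "X \<in> borel_measurable G" and B: "\<And>\<omega>. \<omega> \<in> space M \<Longrightarrow> norm (X \<omega>) \<le> B"
  shows "X \<in> L1w"
proof -
  have [measurable]: "X \<in> borel_measurable M" by (rule measurable_from_subalg[OF subalg X])
  have "norm (\<phi> \<omega> * norm (X \<omega>)) \<le> B" if "\<omega> \<in> space M" for \<omega>
    using mult_mono[OF weight_le_1[OF that] B[OF that]] weight_pos[OF that] by (simp add: abs_mult)
  then have "integrable M (\<lambda>\<omega>. \<phi> \<omega> * norm (X \<omega>))"
    by (intro integrable_const_bound[where B = B] AE_I2) auto
  then show ?thesis using X by (simp add: L1_weighted_def)
qed

locale arbitrage_free_cone = claim_cone +
  assumes no_arbitrage: "arbitrage_free M A"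
    and nonpos_mem: "X \<in> borel_measurable G \<Longrightarrow> (\<And>\<omega> i. X \<omega> $ i \<le> 0) \<Longrightarrow> X \<in> A"
begin

text \<open>Free disposal puts the claim \<open>- axis i 1\<close> on the event
  \<open>Z \<omega> $ i < 0\<close> into \<open>A\<close>, and pairing with it integrates the
  negative part of the coordinate.\<close>

lemma dual_nonneg:
  assumes Z: "Z \<in> dual" shows "AE \<omega> in M. \<forall>i. 0 \<le> Z \<omega> $ i"
proof -
  have "AE \<omega> in M. 0 \<le> Z \<omega> $ i" for i
  proof -
    define X :: "'a \<Rightarrow> real^'b" where "X \<omega> = (if Z \<omega> $ i < 0 then - axis i 1 else 0)" for \<omega>
    have [measurable]: "Z \<in> borel_measurable G" by (rule dual_measurable[OF Z])
    have XG: "X \<in> borel_measurable G" unfolding X_def by measurable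
    have X1: "X \<in> L1w" by (rule bounded_imp_L1w[OF XG, where B = 1]) (simp add: X_def)
    have XA: "X \<in> A" by (rule nonpos_mem[OF XG]) (simp add: X_def axis_def)
    have ZX: "Z \<omega> \<bullet> X \<omega> = max 0 (- Z \<omega> $ i)" for \<omega>
      by (simp add: X_def inner_axis)
    have nn: "AE \<omega> in M. 0 \<le> Z \<omega> \<bullet> X \<omega>" by (simp add: ZX)
    have "(\<integral>\<omega>. Z \<omega> \<bullet> X \<omega> \<partial>M) = 0"
      using dual_inner_le[OF Z XA X1] integral_nonneg_AE[OF nn] by linarith
    then have "AE \<omega> in M. Z \<omega> \<bullet> X \<omega> = 0"
      using integral_nonneg_eq_0_iff_AE[OF integrable_inner[OF Z X1] nn] by simp
    then show ?thesis by eventually_elim (simp add: ZX)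
  qed
  then show ?thesis using AE_finite_allI[of UNIV "\<lambda>i \<omega>. 0 \<le> Z \<omega> $ i" M] by simp
qed

text \<open>The weights sum to one, so the common bound \<open>\<phi>\<close> survives in the
  series, and \<open>\<phi> \<omega> * norm (X \<omega>)\<close> dominates the pairings of all
  partial sums. This provides the countable mixtures needed for the exhaustion.\<close>

lemma dual_suminf:
  fixes Z :: "nat \<Rightarrow> 'a \<Rightarrow> real^'b"
  assumes Z: "\<And>n. Z n \<in> dual" and b: "\<And>n \<omega>. \<omega> \<in> space M \<Longrightarrow> norm (Z n \<omega>) \<le> \<phi> \<omega>"
  shows "(\<lambda>\<omega>. \<Sum>n. (1/2)^Suc n *\<^sub>R Z n \<omega>) \<in> dual"
    and "\<And>\<omega>. \<omega> \<in> space M \<Longrightarrow> summable (\<lambda>n. (1/2)^Suc n *\<^sub>R Z n \<omega>)"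
    and "\<And>\<omega>. \<omega> \<in> space M \<Longrightarrow> norm (\<Sum>n. (1/2)^Suc n *\<^sub>R Z n \<omega>) \<le> \<phi> \<omega>"
proof -
  define S where "S \<omega> = (\<Sum>n. (1/2)^Suc n *\<^sub>R Z n \<omega>)" for \<omega>
  define P where "P N \<omega> = (\<Sum>n<N. (1/2)^Suc n *\<^sub>R Z n \<omega>)" for N \<omega>
  have geo: "(\<lambda>n. (1/2)^Suc n * \<phi> \<omega>) sums \<phi> \<omega>" for \<omega>
    using sums_mult2[OF power_half_series, of "\<phi> \<omega>"] by simp
  have nb: "norm ((1/2)^Suc n *\<^sub>R Z n \<omega>) \<le> (1/2)^Suc n * \<phi> \<omega>" if "\<omega> \<in> space M" for n \<omega>
    using b[OF that, of n] by simp
  have sn: "summable (\<lambda>n. norm ((1/2)^Suc n *\<^sub>R Z n \<omega>))" if "\<omega> \<in> space M" for \<omega>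
    by (rule summable_comparison_test'[OF sums_summable[OF geo], of 0])
       (use nb[OF that] in simp)
  show sm: "summable (\<lambda>n. (1/2)^Suc n *\<^sub>R Z n \<omega>)" if "\<omega> \<in> space M" for \<omega>
    by (rule summable_norm_cancel[OF sn[OF that]])
  have PS: "(\<lambda>N. P N \<omega>) \<longlonglongrightarrow> S \<omega>" if "\<omega> \<in> space M" for \<omega>
    unfolding P_def S_def by (rule summable_LIMSEQ[OF sm[OF that]])
  have Pb: "norm (P N \<omega>) \<le> \<phi> \<omega>" if w: "\<omega> \<in> space M" for N \<omega>
  proof -
    have "norm (P N \<omega>) \<le> (\<Sum>n<N. (1/2)^Suc n * \<phi> \<omega>)"
      unfolding P_def by (rule sum_norm_le) (rule nb[OF w])
    also have "\<dots> \<le> (\<Sum>n. (1/2)^Suc n * \<phi> \<omega>)"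
      by (rule sum_le_suminf[OF sums_summable[OF geo]]) (use weight_pos[OF w] in auto)
    also have "\<dots> = \<phi> \<omega>" by (rule sums_unique[OF geo, symmetric])
    finally show ?thesis .
  qed
  show Sb: "norm (\<Sum>n. (1/2)^Suc n *\<^sub>R Z n \<omega>) \<le> \<phi> \<omega>" if "\<omega> \<in> space M" for \<omega>
    using tendsto_upperbound[OF tendsto_norm[OF PS[OF that]], of "\<phi> \<omega>"] Pb[OF that]
    by (simp add: S_def)
  have Pd: "P N \<in> dual" for N
  proof (induction N)
    case 0
    then show ?case using dual_zero by (simp add: P_def[abs_def])
  next
    case (Suc N)
    have "P (Suc N) = (\<lambda>\<omega>. P N \<omega> + (1/2)^Suc N *\<^sub>R Z N \<omega>)" by (simp add: P_def fun_eq_iff)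
    then show ?case using dual_add[OF Suc dual_scaleR[OF Z, of "(1/2)^Suc N"]] by simp
  qed
  have [measurable]: "Z n \<in> borel_measurable G" for n by (rule dual_measurable[OF Z])
  have "S \<in> dual"
  proof (rule dualI[where C = 1])
    show SG: "S \<in> borel_measurable G"
      unfolding S_def by measurable
    show "AE \<omega> in M. norm (S \<omega>) \<le> 1 * \<phi> \<omega>" using Sb by (auto simp: S_def)
    fix X assume X: "X \<in> A" "X \<in> L1w"
    have [measurable]: "X \<in> borel_measurable M" "S \<in> borel_measurable M" "P N \<in> borel_measurable M" for N
      using L1w_measurable_M[OF X(2)] measurable_from_subalg[OF subalg SG] dual_measurable_M[OF Pd] by auto
    have "(\<lambda>N. \<integral>\<omega>. P N \<omega> \<bullet> X \<omega> \<partial>M) \<longlonglongrightarrow> (\<integral>\<omega>. S \<omega> \<bullet> X \<omega> \<partial>M)"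
    proof (rule integral_dominated_convergence)
      show "integrable M (\<lambda>\<omega>. \<phi> \<omega> * norm (X \<omega>))" using X by (simp add: L1_weighted_def)
      show "AE \<omega> in M. (\<lambda>N. P N \<omega> \<bullet> X \<omega>) \<longlonglongrightarrow> S \<omega> \<bullet> X \<omega>"
        by (intro AE_I2 tendsto_intros PS)
      show "AE \<omega> in M. norm (P N \<omega> \<bullet> X \<omega>) \<le> \<phi> \<omega> * norm (X \<omega>)" for N
        unfolding real_norm_def
        by (intro AE_I2 order_trans[OF Cauchy_Schwarz_ineq2] mult_right_mono Pb) auto
    qed measurable
    then show "(\<integral>\<omega>. S \<omega> \<bullet> X \<omega> \<partial>M) \<le> 0"
      by (rule LIMSEQ_le_const2) (use dual_inner_le[OF Pd X] in blast)
  qed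
  then show "(\<lambda>\<omega>. \<Sum>n. (1/2)^Suc n *\<^sub>R Z n \<omega>) \<in> dual" unfolding S_def .
qed

text \<open>Averaging rather than adding keeps the bound \<open>\<phi>\<close>, so the result may
  compete in the exhaustion.\<close>

lemma dual_half:
  assumes Y: "Y \<in> dual" "\<And>\<omega>. \<omega> \<in> space M \<Longrightarrow> norm (Y \<omega>) \<le> \<phi> \<omega>"
    and Z: "Z \<in> dual" "\<And>\<omega>. \<omega> \<in> space M \<Longrightarrow> norm (Z \<omega>) \<le> \<phi> \<omega>"
  shows "(\<lambda>\<omega>. (1/2) *\<^sub>R (Y \<omega> + Z \<omega>)) \<in> dual"
    and "\<And>\<omega>. \<omega> \<in> space M \<Longrightarrow> norm ((1/2) *\<^sub>R (Y \<omega> + Z \<omega>)) \<le> \<phi> \<omega>"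
proof -
  show "(\<lambda>\<omega>. (1/2) *\<^sub>R (Y \<omega> + Z \<omega>)) \<in> dual"
    using dual_scaleR[OF dual_add[OF Y(1) Z(1)], of "1/2"] by simp
  show "norm ((1/2) *\<^sub>R (Y \<omega> + Z \<omega>)) \<le> \<phi> \<omega>" if "\<omega> \<in> space M" for \<omega>
    using norm_triangle_ineq[of "Y \<omega>" "Z \<omega>"] Y(2)[OF that] Z(2)[OF that] by simp
qed

text \<open>The Kreps--Yan exhaustion argument: among the dual elements bounded by \<open>\<phi>\<close> pick one whose
  \<open>i\<close>-th coordinate is positive with maximal probability. If that probability were less than one,
  separating the arbitrage \<open>1\<^bsub>B\<^esub> e\<^sub>i\<close> on the remaining event \<open>B\<close> would increase it.\<close>

theorem strictly_positive_dual:
  obtains Z where "Z \<in> dual" "AE \<omega> in M. 0 < Z \<omega> $ i"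
proof -
  define D where "D = {Z \<in> dual. \<forall>\<omega>\<in>space M. norm (Z \<omega>) \<le> \<phi> \<omega>}"
  define q where "q Z = prob {\<omega> \<in> space M. 0 < Z \<omega> $ i}" for Z :: "'a \<Rightarrow> real^'b"
  have meas[measurable]: "Z \<in> borel_measurable M" if "Z \<in> D" for Z
    using that dual_measurable_M by (auto simp: D_def)
  have nonneg: "AE \<omega> in M. 0 \<le> Z \<omega> $ i" if "Z \<in> D" for Z
    using dual_nonneg[of Z] that by (auto simp: D_def elim: eventually_mono)
  have D0: "D \<noteq> {}"
    using dual_zero weight_pos by (auto simp: D_def intro!: exI[of _ "\<lambda>_. 0"] less_imp_le)
  have bdd: "bdd_above (q ` D)" by (intro bdd_aboveI[of _ 1]) (auto simp: q_def)
  define s where "s = Sup (q ` D)"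
  have qs: "q Z \<le> s" if "Z \<in> D" for Z
    unfolding s_def using that bdd by (intro cSup_upper) auto
  have "\<exists>Z\<in>D. s - 1 / real (Suc n) < q Z" for n
  proof -
    have "s - 1 / real (Suc n) < Sup (q ` D)" by (simp add: s_def)
    then show ?thesis using less_cSupD[of "q ` D"] D0 by fastforce
  qed
  then obtain Z where ZD: "\<And>n. Z n \<in> D" and Zq: "\<And>n. s - 1 / real (Suc n) < q (Z n)" by metis
  define S where "S \<omega> = (\<Sum>n. (1/2)^Suc n *\<^sub>R Z n \<omega>)" for \<omega>
  have Zd: "Z n \<in> dual" and Zb: "\<omega> \<in> space M \<Longrightarrow> norm (Z n \<omega>) \<le> \<phi> \<omega>" for n \<omega>
    using ZD[of n] by (auto simp: D_def)
  have Sd: "S \<in> dual" and Sb: "\<And>\<omega>. \<omega> \<in> space M \<Longrightarrow> norm (S \<omega>) \<le> \<phi> \<omega>"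
    unfolding S_def[abs_def] using dual_suminf[OF Zd Zb] by auto
  have SD: "S \<in> D" using Sd Sb by (simp add: D_def)
  have [measurable]: "S \<in> borel_measurable M" "\<And>n. Z n \<in> borel_measurable M"
    using SD ZD meas by auto
  have "s \<le> q S"
  proof (rule LIMSEQ_le_const2)
    have "(\<lambda>n. s - 1 / real (Suc n)) \<longlonglongrightarrow> s - 0"
      by (intro tendsto_diff tendsto_const LIMSEQ_Suc[OF lim_inverse_n'])
    then show "(\<lambda>n. s - 1 / real (Suc n)) \<longlonglongrightarrow> s" by (simp only: diff_zero)
    \<comment> \<open>Since the coordinates are almost surely non-negative, the series is positive
      wherever one of its terms is.\<close>
    have "q (Z n) \<le> q S" for n
      unfolding q_def
    proof (rule finite_measure_mono_AE)
      have "AE \<omega> in M. \<forall>n. 0 \<le> Z n \<omega> $ i"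
        unfolding AE_all_countable using nonneg ZD by blast
      then show "AE \<omega> in M. \<omega> \<in> {\<omega> \<in> space M. 0 < Z n \<omega> $ i} \<longrightarrow> \<omega> \<in> {\<omega> \<in> space M. 0 < S \<omega> $ i}"
        using AE_space
      proof eventually_elim
        case (elim \<omega>)
        have "(\<lambda>n. (1/2)^Suc n *\<^sub>R Z n \<omega>) sums S \<omega>"
          unfolding S_def using dual_suminf(2)[OF Zd Zb elim(2)] by (rule summable_sums)
        then have sums: "(\<lambda>n. (1/2)^Suc n * Z n \<omega> $ i) sums (S \<omega> $ i)"
          using bounded_linear.sums[OF bounded_linear_vec_nth[of i]] by fastforce
        show ?case
        proof
          assume "\<omega> \<in> {\<omega> \<in> space M. 0 < Z n \<omega> $ i}"
          then have "0 < (\<Sum>n. (1/2)^Suc n * Z n \<omega> $ i)"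
            using elim by (intro suminf_pos2[OF sums_summable[OF sums], of n]) auto
          then show "\<omega> \<in> {\<omega> \<in> space M. 0 < S \<omega> $ i}"
            using elim sums_unique[OF sums] by simp
        qed
      qed
    qed measurable
    then show "\<exists>N. \<forall>n\<ge>N. s - 1 / real (Suc n) \<le> q S"
      using Zq less_imp_le order_trans by meson
  qed
  define X :: "'a \<Rightarrow> real^'b" where "X \<omega> = (if S \<omega> $ i \<le> 0 then axis i 1 else 0)" for \<omega>
  have [measurable]: "S \<in> borel_measurable G" by (rule dual_measurable[OF Sd])
  have XG: "X \<in> borel_measurable G" unfolding X_def by measurable
  have X1: "X \<in> L1w" by (rule bounded_imp_L1w[OF XG, where B = 1]) (simp add: X_def)
  have "X \<in> A"
  proof (rule ccontr)
    assume "X \<notin> A"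
    with X1 obtain W where W: "W \<in> dual" "\<And>\<omega>. \<omega> \<in> space M \<Longrightarrow> norm (W \<omega>) \<le> \<phi> \<omega>"
      and pos: "0 < (\<integral>\<omega>. W \<omega> \<bullet> X \<omega> \<partial>M)" by (rule separation) blast
    have WD: "W \<in> D" using W by (simp add: D_def)
    then have [measurable]: "W \<in> borel_measurable M" by (rule meas)
    have HD: "(\<lambda>\<omega>. (1/2) *\<^sub>R (S \<omega> + W \<omega>)) \<in> D"
      using dual_half[OF Sd Sb W] by (simp add: D_def)
    \<comment> \<open>Otherwise \<open>W \<omega> \<bullet> X \<omega>\<close>, which is the
      \<open>i\<close>-th coordinate of \<open>W\<close> where that of \<open>S\<close> is at most
      zero and vanishes elsewhere, would be almost surely non-positive, against
      \<open>pos\<close>.\<close>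
    have "0 < prob {\<omega> \<in> space M. S \<omega> $ i \<le> 0 \<and> 0 < W \<omega> $ i}"
    proof (rule ccontr)
      assume "\<not> ?thesis"
      then have "prob {\<omega> \<in> space M. S \<omega> $ i \<le> 0 \<and> 0 < W \<omega> $ i} = 0"
        by (simp add: zero_less_measure_iff)
      then have "AE \<omega> in M. \<not> (S \<omega> $ i \<le> 0 \<and> 0 < W \<omega> $ i)"
        by (intro AE_I'[of "{\<omega> \<in> space M. S \<omega> $ i \<le> 0 \<and> 0 < W \<omega> $ i}"])
           (auto simp: null_sets_def emeasure_eq_measure)
      then have "AE \<omega> in M. W \<omega> \<bullet> X \<omega> \<le> 0"
        by eventually_elim (auto simp: X_def inner_axis)
      then have "(\<integral>\<omega>. W \<omega> \<bullet> X \<omega> \<partial>M) \<le> 0"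
        using integral_mono_AE[OF integrable_inner[OF W(1) X1], of "\<lambda>_. 0"] by simp
      with pos show False by simp
    qed
    then have "q S < prob {\<omega> \<in> space M. 0 < S \<omega> $ i} + prob {\<omega> \<in> space M. S \<omega> $ i \<le> 0 \<and> 0 < W \<omega> $ i}"
      by (simp add: q_def)
    also have "\<dots> = prob ({\<omega> \<in> space M. 0 < S \<omega> $ i} \<union> {\<omega> \<in> space M. S \<omega> $ i \<le> 0 \<and> 0 < W \<omega> $ i})"
      by (intro finite_measure_Union[symmetric]) auto
    also have "\<dots> \<le> q (\<lambda>\<omega>. (1/2) *\<^sub>R (S \<omega> + W \<omega>))"
      unfolding q_def
    proof (rule finite_measure_mono_AE)
      show "AE \<omega> in M. \<omega> \<in> {\<omega> \<in> space M. 0 < S \<omega> $ i} \<union> {\<omega> \<in> space M. S \<omega> $ i \<le> 0 \<and> 0 < W \<omega> $ i} \<longrightarrow>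
          \<omega> \<in> {\<omega> \<in> space M. 0 < ((1/2) *\<^sub>R (S \<omega> + W \<omega>)) $ i}"
        using nonneg[OF SD] nonneg[OF WD] by eventually_elim auto
    qed measurable
    finally show False using qs[OF HD] \<open>s \<le> q S\<close> by linarith
  qed
  \<comment> \<open>\<open>X\<close> is a non-negative element of \<open>A\<close>, so it vanishes
    almost surely, and the event on which it pays is null.\<close>
  moreover have "AE \<omega> in M. \<forall>j. 0 \<le> X \<omega> $ j" by (simp add: X_def axis_def)
  ultimately have "AE \<omega> in M. X \<omega> = 0"
    using no_arbitrage unfolding arbitrage_free_def by blast
  then have "AE \<omega> in M. 0 < S \<omega> $ i"
    by eventually_elim (auto simp: X_def axis_eq_0_iff not_le split: if_splits)
  with Sd show thesis by (rule that)
qed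

end

section \<open>Projection onto random closed cones\<close>

text \<open>Effros measurability speaks of fixed open sets, while the ball around
  \<open>Y \<omega>\<close> moves with \<open>\<omega>\<close>. Replacing its centre by points of a
  countable dense set writes the sublevel event as a countable union built from hitting
  events.\<close>

lemma borel_measurable_infdist_random:
  fixes K :: "'a \<Rightarrow> 'b::euclidean_space set"
  assumes hit: "\<And>U. open U \<Longrightarrow> {\<omega> \<in> space G. K \<omega> \<inter> U \<noteq> {}} \<in> sets G"
    and ne: "\<And>\<omega>. \<omega> \<in> space G \<Longrightarrow> K \<omega> \<noteq> {}"
    and [measurable]: "Y \<in> borel_measurable G"
  shows "(\<lambda>\<omega>. infdist (Y \<omega>) (K \<omega>)) \<in> borel_measurable G"
proof (rule borel_measurable_iff_less[THEN iffD2], rule allI)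
  fix a :: real
  obtain D :: "'b set" where D: "countable D" "\<And>U. open U \<Longrightarrow> U \<noteq> {} \<Longrightarrow> \<exists>d\<in>D. d \<in> U"
    by (rule countable_dense_setE) blast
  have "{\<omega> \<in> space G. infdist (Y \<omega>) (K \<omega>) < a} =
    (\<Union>q\<in>D. \<Union>n. {\<omega> \<in> space G. dist (Y \<omega>) q < 1 / real (Suc n)} \<inter>
       {\<omega> \<in> space G. K \<omega> \<inter> ball q (a - 1 / real (Suc n)) \<noteq> {}})" (is "?L = ?R")
  proof (intro equalityI subsetI)
    fix \<omega> assume "\<omega> \<in> ?L"
    then have w: "\<omega> \<in> space G" and "infdist (Y \<omega>) (K \<omega>) < a" by auto
    then obtain x where x: "x \<in> K \<omega>" "dist (Y \<omega>) x < a"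
      using infdist_notempty[OF ne[OF w], of "Y \<omega>"] cINF_less_iff[OF ne[OF w] bdd_below_image_dist]
      by auto
    \<comment> \<open>Two losses of \<open>1 / real (Suc n)\<close> have to fit into the slack: one
      for moving the centre from \<open>Y \<omega>\<close> to \<open>q\<close>, one for the smaller
      radius.\<close>
    then obtain n where "1 / real (Suc n) < (a - dist (Y \<omega>) x) / 2"
      using nat_approx_posE[of "(a - dist (Y \<omega>) x) / 2"] by auto
    then have n: "2 * (1 / real (Suc n)) < a - dist (Y \<omega>) x" by (simp only: less_divide_eq_numeral1 mult.commute)
    have "ball (Y \<omega>) (1 / real (Suc n)) \<noteq> {}" by (simp del: of_nat_Suc)
    then obtain q where q: "q \<in> D" "dist (Y \<omega>) q < 1 / real (Suc n)"
      using D(2)[OF open_ball] by (metis mem_ball)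
    have "dist q x \<le> dist (Y \<omega>) q + dist (Y \<omega>) x" by (metis dist_commute dist_triangle)
    also have "\<dots> < a - 1 / real (Suc n)" using q(2) n by argo
    finally have "x \<in> K \<omega> \<inter> ball q (a - 1 / real (Suc n))" using x by simp
    then show "\<omega> \<in> ?R" using q w by blast
  next
    fix \<omega> assume "\<omega> \<in> ?R"
    then obtain q n x where w: "\<omega> \<in> space G" and "dist (Y \<omega>) q < 1 / real (Suc n)"
      and x: "x \<in> K \<omega>" "dist q x < a - 1 / real (Suc n)" by auto
    then have "dist (Y \<omega>) x < a" using dist_triangle[of "Y \<omega>" x q] by linarith
    then show "\<omega> \<in> ?L" using w infdist_le[OF x(1), of "Y \<omega>"] by auto
  qed
  also have "\<dots> \<in> sets G"
  proof (rule sets.countable_UN'[OF D(1)], rule image_subsetI, rule sets.countable_UN, rule image_subsetI)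
    fix q :: 'b and n :: nat
    have "{\<omega> \<in> space G. dist (Y \<omega>) q < 1 / real (Suc n)} \<in> sets G" by measurable
    then show "{\<omega> \<in> space G. dist (Y \<omega>) q < 1 / real (Suc n)} \<inter>
        {\<omega> \<in> space G. K \<omega> \<inter> ball q (a - 1 / real (Suc n)) \<noteq> {}} \<in> sets G"
      by (rule sets.Int[OF _ hit[OF open_ball]])
  qed
  finally show "{\<omega> \<in> space G. infdist (Y \<omega>) (K \<omega>) < a} \<in> sets G" .
qed

text \<open>The squared distance to a closed convex set is differentiable with gradient
  \<open>2 (y - closest_point K y)\<close>, so the projection onto a random set is a limit of difference quotients.\<close>

lemma infdist_power2_expansion:
  fixes K :: "'b::euclidean_space set"
  assumes K: "closed K" "convex K" "K \<noteq> {}"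
  shows "\<bar>(infdist (y + v) K)\<^sup>2 - (infdist y K)\<^sup>2 - 2 * (v \<bullet> (y - closest_point K y))\<bar> \<le> (norm v)\<^sup>2"
proof -
  define p where "p = closest_point K y"
  define r where "r = closest_point K (y + v)"
  have mem: "p \<in> K" "r \<in> K" unfolding p_def r_def using closest_point_exists[OF K(1,3)] by blast+
  have dp: "(infdist y K)\<^sup>2 = (y - p) \<bullet> (y - p)"
    unfolding infdist_eq_setdist setdist_closest_point[OF K(1,3)] p_def dist_norm power2_norm_eq_inner ..
  have dr: "(infdist (y + v) K)\<^sup>2 = (y + v - r) \<bullet> (y + v - r)"
    unfolding infdist_eq_setdist setdist_closest_point[OF K(1,3)] r_def dist_norm power2_norm_eq_inner ..
  have "(infdist (y + v) K)\<^sup>2 \<le> (dist (y + v) p)\<^sup>2"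
    by (intro power_mono infdist_le mem infdist_nonneg)
  then have 1: "(infdist (y + v) K)\<^sup>2 \<le> (y + v - p) \<bullet> (y + v - p)"
    by (simp only: dist_norm power2_norm_eq_inner)
  have "(infdist y K)\<^sup>2 \<le> (dist y r)\<^sup>2"
    by (intro power_mono infdist_le mem infdist_nonneg)
  then have 2: "(infdist y K)\<^sup>2 \<le> (y - r) \<bullet> (y - r)"
    by (simp only: dist_norm power2_norm_eq_inner)
  \<comment> \<open>In the lower estimate, where \<open>r\<close> competes for \<open>y\<close>,
    nonexpansiveness of the projection controls the cross term
    \<open>v \<bullet> (r - p)\<close>.\<close>
  have "norm (r - p) \<le> norm v"
    using closest_point_lipschitz[OF K(2,1,3), of "y + v" y] unfolding p_def r_def by (simp add: dist_norm)
  then have "norm v * norm (r - p) \<le> norm v * norm v" by (rule mult_left_mono) simp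
  then have 3: "v \<bullet> (r - p) \<le> v \<bullet> v"
    using norm_cauchy_schwarz[of v "r - p"] by (simp add: power2_norm_eq_inner[symmetric] power2_eq_square)
  have e1: "(y + v - p) \<bullet> (y + v - p) = (y - p) \<bullet> (y - p) + 2 * (v \<bullet> (y - p)) + v \<bullet> v"
    by (simp add: inner_diff inner_add inner_commute)
  have e2: "(y - r) \<bullet> (y - r) = (y + v - r) \<bullet> (y + v - r) - 2 * (v \<bullet> (y - p)) - v \<bullet> v + 2 * (v \<bullet> (r - p))"
    by (simp add: inner_diff inner_add inner_commute)
  have "(infdist (y + v) K)\<^sup>2 - (infdist y K)\<^sup>2 - 2 * (v \<bullet> (y - p)) \<le> v \<bullet> v"
    using 1 e1 dp by argo
  moreover have "- ((infdist (y + v) K)\<^sup>2 - (infdist y K)\<^sup>2 - 2 * (v \<bullet> (y - p))) \<le> v \<bullet> v"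
    using 2 3 e2 dr by argo
  ultimately show ?thesis
    unfolding p_def power2_norm_eq_inner by (rule abs_leI)
qed

lemma borel_measurable_closest_point_random:
  fixes K :: "'a \<Rightarrow> 'b::euclidean_space set"
  assumes hit: "\<And>U. open U \<Longrightarrow> {\<omega> \<in> space G. K \<omega> \<inter> U \<noteq> {}} \<in> sets G"
    and K: "\<And>\<omega>. \<omega> \<in> space G \<Longrightarrow> closed (K \<omega>) \<and> convex (K \<omega>) \<and> K \<omega> \<noteq> {}"
    and [measurable]: "Y \<in> borel_measurable G"
  shows "(\<lambda>\<omega>. closest_point (K \<omega>) (Y \<omega>)) \<in> borel_measurable G"
proof (rule borel_measurable_euclidean_space[THEN iffD2], rule ballI)
  fix i :: 'b assume i: "i \<in> Basis"
  define d where "d y \<omega> = (infdist (y \<omega>) (K \<omega>))\<^sup>2" for y \<omega>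
  have [measurable]: "d y \<in> borel_measurable G" if [measurable]: "y \<in> borel_measurable G" for y
    unfolding d_def
    by (intro borel_measurable_power borel_measurable_infdist_random[OF hit]) (use K in auto)
  \<comment> \<open>Half the difference quotient of the squared distance in direction
    \<open>i\<close> approximates that coordinate of
    \<open>Y \<omega> - closest_point (K \<omega>) (Y \<omega>)\<close>; the error is at most half
    the step \<open>1 / real (Suc n)\<close>.\<close>
  define f where "f n \<omega> = Y \<omega> \<bullet> i -
    real (Suc n) * (d (\<lambda>\<omega>. Y \<omega> + (1 / real (Suc n)) *\<^sub>R i) \<omega> - d Y \<omega>) / 2" for n \<omega>
  show "(\<lambda>\<omega>. closest_point (K \<omega>) (Y \<omega>) \<bullet> i) \<in> borel_measurable G"
  proof (rule borel_measurable_LIMSEQ_real)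
    show "f n \<in> borel_measurable G" for n unfolding f_def by measurable
    fix \<omega> assume w: "\<omega> \<in> space G"
    let ?p = "closest_point (K \<omega>) (Y \<omega>)"
    have bound: "norm (f n \<omega> - ?p \<bullet> i) \<le> 1 / real (Suc n)" for n
    proof -
      define t where "t = 1 / real (Suc n)"
      have t: "0 < t" by (simp add: t_def)
      let ?e = "d (\<lambda>\<omega>. Y \<omega> + t *\<^sub>R i) \<omega> - d Y \<omega> - 2 * (t * (i \<bullet> (Y \<omega> - ?p)))"
      have e: "\<bar>?e\<bar> \<le> t\<^sup>2"
        using infdist_power2_expansion[of "K \<omega>" "Y \<omega>" "t *\<^sub>R i"] K[OF w] i by (simp add: d_def)
      have rt: "real (Suc n) = 1 / t" by (simp add: t_def)
      have "f n \<omega> - ?p \<bullet> i = - (?e / (2 * t))"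
        using t unfolding f_def rt by (simp add: inner_commute inner_diff field_simps)
      then have "norm (f n \<omega> - ?p \<bullet> i) = \<bar>?e\<bar> / (2 * t)" using t by simp
      also have "\<dots> \<le> t\<^sup>2 / (2 * t)" using e t by (intro divide_right_mono) auto
      also have "\<dots> \<le> t" using t by (simp add: power2_eq_square)
      finally show ?thesis by (simp add: t_def)
    qed
    have "(\<lambda>n. f n \<omega> - ?p \<bullet> i) \<longlonglongrightarrow> 0"
      by (rule Lim_null_comparison[OF always_eventually[OF allI[OF bound]] LIMSEQ_Suc[OF lim_inverse_n']])
    then show "(\<lambda>n. f n \<omega>) \<longlonglongrightarrow> ?p \<bullet> i" by (simp only: LIM_zero_iff)
  qed
qed

text \<open>The obtuse angle criterion for the projection, tested at \<open>0\<close> and at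
  \<open>2 *\<^sub>R p\<close>, makes \<open>y - p\<close> orthogonal to \<open>p\<close>. So
  \<open>p\<close> is nonzero exactly when \<open>y\<close> lies outside the polar cone, and then
  \<open>y \<bullet> p > 0\<close> exhibits this.\<close>

lemma closest_point_convex_cone:
  fixes K :: "'b::euclidean_space set" and y :: 'b
  assumes K: "closed K" "convex_cone K"
  defines "p \<equiv> closest_point K y"
  shows "p \<in> K" and "y \<bullet> p = p \<bullet> p" and "p = 0 \<Longrightarrow> x \<in> K \<Longrightarrow> y \<bullet> x \<le> 0"
proof -
  have cx: "convex K" and ne: "K \<noteq> {}" using K(2) by (auto simp: convex_cone_def)
  show pK: "p \<in> K" unfolding p_def by (rule closest_point_in_set[OF K(1) ne])
  have dot: "(y - p) \<bullet> (x - p) \<le> 0" if "x \<in> K" for x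
    unfolding p_def by (rule closest_point_dot[OF cx K(1) that])
  have "2 *\<^sub>R p \<in> K" by (rule convex_cone_scaleR[OF K(2) _ pK]) simp
  from dot[OF this] dot[OF convex_cone_contains_0[OF K(2)]]
  show "y \<bullet> p = p \<bullet> p" by (simp add: inner_diff scaleR_2)
  show "y \<bullet> x \<le> 0" if "p = 0" "x \<in> K" using dot[OF that(2)] that(1) by simp
qed

section \<open>Martingales with dual terminal value\<close>

lemma (in finite_measure) sigma_finite_subalgebraI:
  "subalgebra M G \<Longrightarrow> sigma_finite_subalgebra M G"
  by (intro finite_measure_subalgebra_is_sigma_finite finite_measure_subalgebra.intro
      finite_measure_subalgebra_axioms.intro finite_measure_axioms)

lemma borel_measurable_component[measurable (raw)]:
  fixes f :: "'a \<Rightarrow> real^'d"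
  shows "f \<in> borel_measurable N \<Longrightarrow> (\<lambda>x. f x $ i) \<in> borel_measurable N"
  by (rule measurable_compose[OF _ borel_measurable_nth])

locale filtered_claim_cone = arbitrage_free_cone M "F T" \<phi> A
  for M :: "'a measure" and F :: "nat \<Rightarrow> 'a measure" and T :: nat and \<phi> :: "'a \<Rightarrow> real"
    and A :: "('a \<Rightarrow> real^'d) set" +
  assumes filtration: "\<And>t. t \<le> T \<Longrightarrow> subalgebra M (F t)"
    and filtration_mono: "\<And>s t. s \<le> t \<Longrightarrow> t \<le> T \<Longrightarrow> sets (F s) \<subseteq> sets (F t)"
begin

lemma space_F: "t \<le> T \<Longrightarrow> space (F t) = space M"
  using filtration by (simp add: subalgebra_def)

lemma subalgebra_F: "s \<le> t \<Longrightarrow> t \<le> T \<Longrightarrow> subalgebra (F t) (F s)"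
  using filtration_mono space_F by (simp add: subalgebra_def)

lemma measurable_F_mono: "s \<le> t \<Longrightarrow> t \<le> T \<Longrightarrow> H \<in> borel_measurable (F s) \<Longrightarrow> H \<in> borel_measurable (F t)"
  using measurable_from_subalg[OF subalgebra_F] .

lemma measurable_F_M: "t \<le> T \<Longrightarrow> H \<in> borel_measurable (F t) \<Longrightarrow> H \<in> borel_measurable M"
  using measurable_from_subalg[OF filtration] .

lemma martingale_measurable: "martingale M F T Z \<Longrightarrow> t \<le> T \<Longrightarrow> Z t \<in> borel_measurable (F t)"
  by (simp add: martingale_def adapted_def)

text \<open>The bound by a multiple of \<open>\<phi>\<close> is available for \<open>Z T\<close>
  only, since \<open>\<phi>\<close> need not be measurable at earlier times. Integrability of the
  pairing with \<open>Z t\<close> is therefore obtained last, by recognising it as a conditional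
  expectation of the integrable pairing with \<open>Z T\<close>. Coordinates are treated separately
  because \<open>real_cond_exp\<close> is real-valued.\<close>

lemma martingale_inner_terminal:
  assumes Z: "martingale M F T Z" "Z T \<in> dual" and t: "t \<le> T"
    and H: "H \<in> borel_measurable (F t)" "H \<in> L1w"
  shows "integrable M (\<lambda>\<omega>. H \<omega> \<bullet> Z t \<omega>)"
    and "AE \<omega> in M. real_cond_exp M (F t) (\<lambda>\<omega>. H \<omega> \<bullet> Z T \<omega>) \<omega> = H \<omega> \<bullet> Z t \<omega>"
    and "(\<integral>\<omega>. H \<omega> \<bullet> Z T \<omega> \<partial>M) = (\<integral>\<omega>. H \<omega> \<bullet> Z t \<omega> \<partial>M)"
proof -
  interpret sigma_finite_subalgebra M "F t" by (rule sigma_finite_subalgebraI[OF filtration[OF t]])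
  have [measurable]: "H \<in> borel_measurable M" "Z T \<in> borel_measurable M" "Z t \<in> borel_measurable M"
    using measurable_F_M[OF t H(1)] dual_measurable_M[OF Z(2)]
      measurable_F_M[OF t martingale_measurable[OF Z(1) t]] by auto
  obtain C where C: "AE \<omega> in M. norm (Z T \<omega>) \<le> C * \<phi> \<omega>" using dual_bounded[OF Z(2)] by blast
  have int: "integrable M (\<lambda>\<omega>. H \<omega> $ i * Z T \<omega> $ i)" for i
  proof (rule Bochner_Integration.integrable_bound)
    show "integrable M (\<lambda>\<omega>. C * (\<phi> \<omega> * norm (H \<omega>)))" using H by (simp add: L1_weighted_def)
    show "AE \<omega> in M. norm (H \<omega> $ i * Z T \<omega> $ i) \<le> norm (C * (\<phi> \<omega> * norm (H \<omega>)))"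
      using C
    proof eventually_elim
      case (elim \<omega>)
      have "norm (H \<omega> $ i * Z T \<omega> $ i) \<le> norm (H \<omega>) * norm (Z T \<omega>)"
        by (simp add: abs_mult mult_mono component_le_norm_cart)
      also have "\<dots> \<le> norm (H \<omega>) * (C * \<phi> \<omega>)" using elim by (intro mult_left_mono) auto
      finally show ?case by (simp add: mult_ac)
    qed
  qed measurable
  have "AE \<omega> in M. real_cond_exp M (F t) (\<lambda>\<omega>. H \<omega> $ i * Z T \<omega> $ i) \<omega> = H \<omega> $ i * Z t \<omega> $ i" for i
  proof -
    have "AE \<omega> in M. real_cond_exp M (F t) (\<lambda>\<omega>. H \<omega> $ i * Z T \<omega> $ i) \<omega>
        = H \<omega> $ i * real_cond_exp M (F t) (\<lambda>\<omega>. Z T \<omega> $ i) \<omega>"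
      using H(1) by (intro real_cond_exp_mult int) auto
    moreover have "AE \<omega> in M. real_cond_exp M (F t) (\<lambda>\<omega>. Z T \<omega> $ i) \<omega> = Z t \<omega> $ i"
      using Z(1) t unfolding martingale_def by blast
    ultimately show ?thesis by eventually_elim simp
  qed
  then have "AE \<omega> in M. \<forall>i\<in>UNIV.
      real_cond_exp M (F t) (\<lambda>\<omega>. H \<omega> $ i * Z T \<omega> $ i) \<omega> = H \<omega> $ i * Z t \<omega> $ i"
    by (intro AE_finite_allI) auto
  moreover have "AE \<omega> in M. real_cond_exp M (F t) (\<lambda>\<omega>. \<Sum>i\<in>UNIV. H \<omega> $ i * Z T \<omega> $ i) \<omega>
      = (\<Sum>i\<in>UNIV. real_cond_exp M (F t) (\<lambda>\<omega>. H \<omega> $ i * Z T \<omega> $ i) \<omega>)"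
    by (rule real_cond_exp_sum[OF int])
  ultimately show ce: "AE \<omega> in M. real_cond_exp M (F t) (\<lambda>\<omega>. H \<omega> \<bullet> Z T \<omega>) \<omega> = H \<omega> \<bullet> Z t \<omega>"
    unfolding inner_vec_def inner_real_def by eventually_elim simp
  have iT: "integrable M (\<lambda>\<omega>. H \<omega> \<bullet> Z T \<omega>)"
    using int unfolding inner_vec_def inner_real_def by (rule Bochner_Integration.integrable_sum)
  show "integrable M (\<lambda>\<omega>. H \<omega> \<bullet> Z t \<omega>)"
    by (rule integrable_cong_AE_imp[OF real_cond_exp_int(1)[OF iT]]) (use ce in \<open>auto elim: eventually_mono\<close>)
  show "(\<integral>\<omega>. H \<omega> \<bullet> Z T \<omega> \<partial>M) = (\<integral>\<omega>. H \<omega> \<bullet> Z t \<omega> \<partial>M)"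
    unfolding real_cond_exp_int(2)[OF iT, symmetric] by (rule integral_cong_AE[OF _ _ ce]) measurable
qed

text \<open>Both intermediate pairings are conditional expectations of the terminal one, so this is
  the tower property.\<close>

lemma martingale_inner_cond_exp:
  assumes Z: "martingale M F T Z" "Z T \<in> dual" and t: "t \<le> u" "u \<le> T"
    and H: "H \<in> borel_measurable (F t)" "H \<in> L1w"
  shows "AE \<omega> in M. real_cond_exp M (F t) (\<lambda>\<omega>. H \<omega> \<bullet> Z u \<omega>) \<omega> = H \<omega> \<bullet> Z t \<omega>"
proof -
  have tT: "t \<le> T" using t by simp
  interpret t: sigma_finite_subalgebra M "F t" by (rule sigma_finite_subalgebraI[OF filtration[OF tT]])
  have Hu: "H \<in> borel_measurable (F u)" by (rule measurable_F_mono[OF t H(1)])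
  have [measurable]: "H \<in> borel_measurable M" "Z u \<in> borel_measurable M"
    using measurable_F_M[OF tT H(1)] measurable_F_M[OF t(2) martingale_measurable[OF Z(1) t(2)]] by auto
  have "integrable M (\<lambda>\<omega>. H \<omega> \<bullet> Z T \<omega>)"
    using integrable_inner[OF Z(2) H(2)] by (simp add: inner_commute)
  from t.real_cond_exp_nested_subalg[OF filtration[OF t(2)] subalgebra_F[OF t] this]
  have "AE \<omega> in M. real_cond_exp M (F t) (real_cond_exp M (F u) (\<lambda>\<omega>. H \<omega> \<bullet> Z T \<omega>)) \<omega>
      = real_cond_exp M (F t) (\<lambda>\<omega>. H \<omega> \<bullet> Z T \<omega>) \<omega>" .
  moreover have "AE \<omega> in M. real_cond_exp M (F t) (real_cond_exp M (F u) (\<lambda>\<omega>. H \<omega> \<bullet> Z T \<omega>)) \<omega>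
      = real_cond_exp M (F t) (\<lambda>\<omega>. H \<omega> \<bullet> Z u \<omega>) \<omega>"
    by (rule t.real_cond_exp_cong[OF martingale_inner_terminal(2)[OF Z t(2) Hu H(2)]]) measurable
  moreover have "AE \<omega> in M. real_cond_exp M (F t) (\<lambda>\<omega>. H \<omega> \<bullet> Z T \<omega>) \<omega> = H \<omega> \<bullet> Z t \<omega>"
    by (rule martingale_inner_terminal(2)[OF Z tT H])
  ultimately show ?thesis by eventually_elim simp
qed

lemma L1w_scaleR_bounded:
  assumes t: "t \<le> T" and H: "H \<in> borel_measurable (F t)" "H \<in> L1w" and c: "c \<in> bounded_nonneg (F t)"
  shows "(\<lambda>\<omega>. c \<omega> *\<^sub>R H \<omega>) \<in> borel_measurable (F t)" "(\<lambda>\<omega>. c \<omega> *\<^sub>R H \<omega>) \<in> L1w"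
proof -
  have [measurable]: "c \<in> borel_measurable (F t)" using c by (simp add: bounded_nonneg_def)
  obtain B where B: "\<And>\<omega>. \<omega> \<in> space M \<Longrightarrow> 0 \<le> c \<omega> \<and> c \<omega> \<le> B"
    using c space_F[OF t] by (auto simp: bounded_nonneg_def)
  show m: "(\<lambda>\<omega>. c \<omega> *\<^sub>R H \<omega>) \<in> borel_measurable (F t)" using H(1) by measurable
  show "(\<lambda>\<omega>. c \<omega> *\<^sub>R H \<omega>) \<in> L1w"
  proof (rule L1w_bounded[OF L1w_scaleR[OF H(2), of B] L1w_scaleR[OF H(2), of 0]])
    show "(\<lambda>\<omega>. c \<omega> *\<^sub>R H \<omega>) \<in> borel_measurable (F T)"
      by (rule measurable_F_mono[OF t order_refl m])
    show "AE \<omega> in M. norm (c \<omega> *\<^sub>R H \<omega>) \<le> norm (B *\<^sub>R H \<omega>) + norm (0 *\<^sub>R H \<omega>)"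
    proof (rule AE_I2)
      fix \<omega> assume "\<omega> \<in> space M"
      from B[OF this] show "norm (c \<omega> *\<^sub>R H \<omega>) \<le> norm (B *\<^sub>R H \<omega>) + norm (0 *\<^sub>R H \<omega>)"
        by (simp add: mult_right_mono)
    qed
  qed
qed

text \<open>Conditioning moves a pairing with \<open>Z T\<close> to one with \<open>Z t\<close>,
  where non-negative factors \<open>c\<close> detect the sign pointwise. The products of
  \<open>c\<close> and \<open>H\<close> are exactly the claims tested in
  \<open>trade_cone\<close>.\<close>

lemma martingale_inner_nonpos_iff:
  assumes Z: "martingale M F T Z" "Z T \<in> dual" and t: "t \<le> T"
    and H: "H \<in> borel_measurable (F t)" "H \<in> L1w"
  shows "(AE \<omega> in M. H \<omega> \<bullet> Z t \<omega> \<le> 0) \<longleftrightarrow>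
    (\<forall>c\<in>bounded_nonneg (F t). (\<integral>\<omega>. Z T \<omega> \<bullet> (c \<omega> *\<^sub>R H \<omega>) \<partial>M) \<le> 0)"
proof
  assume le: "AE \<omega> in M. H \<omega> \<bullet> Z t \<omega> \<le> 0"
  show "\<forall>c\<in>bounded_nonneg (F t). (\<integral>\<omega>. Z T \<omega> \<bullet> (c \<omega> *\<^sub>R H \<omega>) \<partial>M) \<le> 0"
  proof
    fix c assume c: "c \<in> bounded_nonneg (F t)"
    note cH = L1w_scaleR_bounded[OF t H c]
    have "AE \<omega> in M. 0 \<le> - ((c \<omega> *\<^sub>R H \<omega>) \<bullet> Z t \<omega>)"
      using le AE_space
    proof eventually_elim
      case (elim \<omega>)
      then show ?case using c space_F[OF t] by (auto simp: bounded_nonneg_def mult_nonneg_nonpos)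
    qed
    then have "0 \<le> (\<integral>\<omega>. - ((c \<omega> *\<^sub>R H \<omega>) \<bullet> Z t \<omega>) \<partial>M)" by (rule integral_nonneg_AE)
    moreover have "(\<integral>\<omega>. - ((c \<omega> *\<^sub>R H \<omega>) \<bullet> Z t \<omega>) \<partial>M) = - (\<integral>\<omega>. (c \<omega> *\<^sub>R H \<omega>) \<bullet> Z t \<omega> \<partial>M)"
      by (rule Bochner_Integration.integral_minus)
    moreover have "(\<integral>\<omega>. Z T \<omega> \<bullet> (c \<omega> *\<^sub>R H \<omega>) \<partial>M) = (\<integral>\<omega>. (c \<omega> *\<^sub>R H \<omega>) \<bullet> Z t \<omega> \<partial>M)"
      unfolding inner_commute[of "Z T _"] by (rule martingale_inner_terminal(3)[OF Z t cH])
    ultimately show "(\<integral>\<omega>. Z T \<omega> \<bullet> (c \<omega> *\<^sub>R H \<omega>) \<partial>M) \<le> 0" by linarith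
  qed
next
  assume le: "\<forall>c\<in>bounded_nonneg (F t). (\<integral>\<omega>. Z T \<omega> \<bullet> (c \<omega> *\<^sub>R H \<omega>) \<partial>M) \<le> 0"
  \<comment> \<open>The indicator of the bad event makes the pairing equal to the mean of the
    positive part of \<open>H \<omega> \<bullet> Z t \<omega>\<close>.\<close>
  define c where "c \<omega> = (if 0 < H \<omega> \<bullet> Z t \<omega> then 1 else 0 :: real)" for \<omega>
  have [measurable]: "H \<in> borel_measurable (F t)" "Z t \<in> borel_measurable (F t)"
    using H martingale_measurable[OF Z(1) t] by auto
  have "c \<in> borel_measurable (F t)" unfolding c_def by measurable
  then have c: "c \<in> bounded_nonneg (F t)"
    by (auto simp: bounded_nonneg_def c_def intro!: exI[of _ 1])
  note cH = L1w_scaleR_bounded[OF t H c]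
  have ce: "(c \<omega> *\<^sub>R H \<omega>) \<bullet> Z t \<omega> = max 0 (H \<omega> \<bullet> Z t \<omega>)" for \<omega> by (simp add: c_def)
  have nn: "AE \<omega> in M. 0 \<le> (c \<omega> *\<^sub>R H \<omega>) \<bullet> Z t \<omega>" unfolding ce by simp
  have "(\<integral>\<omega>. Z T \<omega> \<bullet> (c \<omega> *\<^sub>R H \<omega>) \<partial>M) = (\<integral>\<omega>. (c \<omega> *\<^sub>R H \<omega>) \<bullet> Z t \<omega> \<partial>M)"
    unfolding inner_commute[of "Z T _"] by (rule martingale_inner_terminal(3)[OF Z t cH])
  then have "(\<integral>\<omega>. (c \<omega> *\<^sub>R H \<omega>) \<bullet> Z t \<omega> \<partial>M) = 0"
    using le c integral_nonneg_AE[OF nn] by fastforce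
  then have "AE \<omega> in M. (c \<omega> *\<^sub>R H \<omega>) \<bullet> Z t \<omega> = 0"
    using integral_nonneg_eq_0_iff_AE[OF martingale_inner_terminal(1)[OF Z t cH] nn] by blast
  then show "AE \<omega> in M. H \<omega> \<bullet> Z t \<omega> \<le> 0"
    unfolding ce by eventually_elim (simp add: max_def split: if_splits)
qed

section \<open>The lagged process and its supermartingale property\<close>

lemma lag_measurable:
  assumes "adapted F T (\<eta> :: nat \<Rightarrow> 'a \<Rightarrow> real^'d)" "t \<le> T"
  shows "lag \<eta> t \<in> borel_measurable (F t)"
proof (cases t)
  case (Suc s)
  then show ?thesis
    using assms measurable_F_mono[of s t "\<eta> s"] by (simp add: lag_def adapted_def)
qed (simp add: lag_def)

lemma lag_L1w:
  assumes "\<forall>t\<le>T. \<eta> t \<in> L1w" "t \<le> T"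
  shows "lag \<eta> t \<in> L1w"
  using assms by (cases t) (auto simp: lag_def L1_weighted_def)

text \<open>The one-step inequality from \<open>t\<close> to \<open>Suc t\<close> is the sign
  condition at \<open>t\<close>, so the supermartingale property covers only \<open>t < T\<close>;
  the terminal inequality supplies the missing case \<open>t = T\<close>. At time zero the lagged
  process is zero and the condition is on \<open>\<eta> 0\<close> itself.\<close>

lemma supermartingale_lag_iff:
  assumes Z: "martingale M F T Z" "Z T \<in> dual"
    and \<eta>: "adapted F T \<eta>" "\<forall>t\<le>T. \<eta> t \<in> L1w" and \<theta>: "AE \<omega> in M. \<eta> T \<omega> = \<theta> \<omega>"
  shows "supermartingale M F T (\<lambda>t \<omega>. lag \<eta> t \<omega> \<bullet> Z t \<omega>) \<and>
      (AE \<omega> in M. \<theta> \<omega> \<bullet> Z T \<omega> \<le> lag \<eta> T \<omega> \<bullet> Z T \<omega>) \<longleftrightarrow>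
    (\<forall>t\<le>T. AE \<omega> in M. (\<eta> t \<omega> - lag \<eta> t \<omega>) \<bullet> Z t \<omega> \<le> 0)"
    (is "?S \<and> ?E \<longleftrightarrow> ?R")
proof -
  have one_step: "AE \<omega> in M. real_cond_exp M (F t) (\<lambda>\<omega>. lag \<eta> (Suc t) \<omega> \<bullet> Z (Suc t) \<omega>) \<omega> = \<eta> t \<omega> \<bullet> Z t \<omega>"
    if "Suc t \<le> T" for t
  proof -
    have "AE \<omega> in M. real_cond_exp M (F t) (\<lambda>\<omega>. \<eta> t \<omega> \<bullet> Z (Suc t) \<omega>) \<omega> = \<eta> t \<omega> \<bullet> Z t \<omega>"
      using that \<eta> by (intro martingale_inner_cond_exp[OF Z]) (auto simp: adapted_def)
    then show ?thesis by (simp add: lag_def)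
  qed
  have int: "integrable M (\<lambda>\<omega>. lag \<eta> t \<omega> \<bullet> Z t \<omega>)" if "t \<le> T" for t
    by (rule martingale_inner_terminal(1)[OF Z that lag_measurable[OF \<eta>(1) that] lag_L1w[OF \<eta>(2) that]])
  have meas: "(\<lambda>\<omega>. lag \<eta> t \<omega> \<bullet> Z t \<omega>) \<in> borel_measurable (F t)" if "t \<le> T" for t
    using lag_measurable[OF \<eta>(1) that] martingale_measurable[OF Z(1) that] by measurable
  show ?thesis
  proof
    assume SE: "?S \<and> ?E"
    show ?R
    proof (intro allI impI)
      fix t assume t: "t \<le> T"
      show "AE \<omega> in M. (\<eta> t \<omega> - lag \<eta> t \<omega>) \<bullet> Z t \<omega> \<le> 0"
      proof (cases "t = T")
        case True
        have ?E using SE by blast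
        with \<theta> show ?thesis unfolding True by eventually_elim (simp add: inner_diff_left)
      next
        case False
        then have t': "Suc t \<le> T" using t by simp
        then have "AE \<omega> in M. real_cond_exp M (F t) (\<lambda>\<omega>. lag \<eta> (Suc t) \<omega> \<bullet> Z (Suc t) \<omega>) \<omega> \<le> lag \<eta> t \<omega> \<bullet> Z t \<omega>"
          using SE le_SucI[OF order_refl] unfolding supermartingale_def by blast
        with one_step[OF t'] show ?thesis by eventually_elim (simp add: inner_diff_left)
      qed
    qed
  next
    assume R: ?R
    have R': "AE \<omega> in M. \<eta> t \<omega> \<bullet> Z t \<omega> \<le> lag \<eta> t \<omega> \<bullet> Z t \<omega>" if "t \<le> T" for t
      using R[rule_format, OF that] by eventually_elim (simp add: inner_diff_left)
    have "AE \<omega> in M. real_cond_exp M (F s) (\<lambda>\<omega>. lag \<eta> t \<omega> \<bullet> Z t \<omega>) \<omega> \<le> lag \<eta> s \<omega> \<bullet> Z s \<omega>"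
      if "s \<le> t" "t \<le> T" for s t
      using that
    \<comment> \<open>The definition asks for all pairs of times; the one-step inequalities are
      chained by the tower property.\<close>
    proof (induction t rule: dec_induct)
      case base
      interpret sigma_finite_subalgebra M "F s" by (rule sigma_finite_subalgebraI[OF filtration[OF base]])
      show ?case
        using real_cond_exp_F_meas[OF int[OF base] meas[OF base]] by eventually_elim simp
    next
      case (step n)
      then have n: "n \<le> T" "Suc n \<le> T" and s: "s \<le> T" by auto
      interpret s: sigma_finite_subalgebra M "F s" by (rule sigma_finite_subalgebraI[OF filtration[OF s]])
      interpret n: sigma_finite_subalgebra M "F n" by (rule sigma_finite_subalgebraI[OF filtration[OF n(1)]])
      let ?Y = "\<lambda>\<omega>. lag \<eta> (Suc n) \<omega> \<bullet> Z (Suc n) \<omega>"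
      have "AE \<omega> in M. real_cond_exp M (F n) ?Y \<omega> \<le> lag \<eta> n \<omega> \<bullet> Z n \<omega>"
        using one_step[OF n(2)] R'[OF n(1)]
        by eventually_elim simp
      then have "AE \<omega> in M. real_cond_exp M (F s) (real_cond_exp M (F n) ?Y) \<omega>
          \<le> real_cond_exp M (F s) (\<lambda>\<omega>. lag \<eta> n \<omega> \<bullet> Z n \<omega>) \<omega>"
        by (rule s.real_cond_exp_mono[OF _ n.real_cond_exp_int(1)[OF int[OF n(2)]] int[OF n(1)]])
      moreover have "AE \<omega> in M. real_cond_exp M (F s) (real_cond_exp M (F n) ?Y) \<omega> = real_cond_exp M (F s) ?Y \<omega>"
        by (rule s.real_cond_exp_nested_subalg[OF filtration[OF n(1)] subalgebra_F[OF step(1) n(1)] int[OF n(2)]])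
      moreover have "AE \<omega> in M. real_cond_exp M (F s) (\<lambda>\<omega>. lag \<eta> n \<omega> \<bullet> Z n \<omega>) \<omega> \<le> lag \<eta> s \<omega> \<bullet> Z s \<omega>"
        by (rule step.IH[OF n(1)])
      ultimately show ?case by eventually_elim simp
    qed
    then have ?S using int meas by (auto simp: supermartingale_def adapted_def)
    moreover have ?E using R'[OF order_refl] \<theta> by eventually_elim simp
    ultimately show "?S \<and> ?E" ..
  qed
qed

end

section \<open>Consistent price processes\<close>

lemma convex_cone_sum:
  assumes "convex_cone S" "finite I" "\<And>i. i \<in> I \<Longrightarrow> x i \<in> S"
  shows "(\<Sum>i\<in>I. x i) \<in> S"
  using assms(2,3)
  by (induction I rule: finite_induct) (auto intro: convex_cone_add convex_cone_contains_0 assms(1))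

text \<open>Free disposal at the level of cones: \<open>- x\<close> is a combination of the unit
  vectors among the generators, with the non-negative coefficients \<open>- x $ i\<close>.\<close>

lemma nonpos_mem_neg_solvency_cone:
  fixes x :: "real^'d"
  assumes "\<And>i. x $ i \<le> 0"
  shows "x \<in> uminus ` solvency_cone P"
proof -
  have "(\<Sum>i\<in>UNIV. (- x $ i) *\<^sub>R axis i (1::real)) \<in> solvency_cone P"
    unfolding solvency_cone_def
  proof (intro convex_cone_sum convex_cone_hull_mul convex_cone_convex_cone_hull)
    fix i :: 'd
    show "axis i 1 \<in> convex_cone hull (range (\<lambda>i. axis i (1::real)) \<union> range (\<lambda>(i, j). P $ i $ j *\<^sub>R axis i 1 - axis j 1))"
      by (rule hull_inc) blast
  qed (use assms in auto)
  moreover have "(\<Sum>i\<in>UNIV. (- x $ i) *\<^sub>R axis i (1::real)) = - x"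
    by (simp add: vec_eq_iff axis_def if_distrib[of "(*) _"] sum_negf cong: if_cong)
  ultimately show ?thesis by (metis imageI minus_minus)
qed

text \<open>The trades at all other dates are set to zero, which is why zero must lie in every
  cone.\<close>

lemma sum_cone_single:
  assumes t: "t \<le> T" and X: "X \<in> L0 M (F t) (S t)"
    and zero: "\<And>s. s \<le> T \<Longrightarrow> AE \<omega> in M. 0 \<in> S s \<omega>"
  shows "X \<in> sum_cone M F T S"
proof -
  define \<zeta> where "\<zeta> s = (if s = t then X else (\<lambda>_. 0))" for s
  have "\<forall>s\<le>T. \<zeta> s \<in> L0 M (F s) (S s)" using X zero by (auto simp: \<zeta>_def L0_def)
  moreover have "X = (\<lambda>\<omega>. \<Sum>s\<le>T. \<zeta> s \<omega>)"
  proof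
    fix \<omega>
    have "(\<Sum>s\<le>T. \<zeta> s \<omega>) = (\<Sum>s\<le>T. if s = t then X \<omega> else 0)"
      by (intro sum.cong) (auto simp: \<zeta>_def)
    then show "X \<omega> = (\<Sum>s\<le>T. \<zeta> s \<omega>)" using t by simp
  qed
  ultimately show ?thesis unfolding sum_cone_def by blast
qed

lemma sum_cone_add_scaleR:
  assumes cone: "\<And>s. s \<le> T \<Longrightarrow> AE \<omega> in M. convex_cone (S s \<omega>)"
    and X: "X \<in> sum_cone M F T S"
  shows "Y \<in> sum_cone M F T S \<Longrightarrow> (\<lambda>\<omega>. X \<omega> + Y \<omega>) \<in> sum_cone M F T S"
    and "0 \<le> c \<Longrightarrow> (\<lambda>\<omega>. c *\<^sub>R X \<omega>) \<in> sum_cone M F T S"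
proof -
  obtain \<zeta> where \<zeta>: "X = (\<lambda>\<omega>. \<Sum>t\<le>T. \<zeta> t \<omega>)" "\<And>t. t \<le> T \<Longrightarrow> \<zeta> t \<in> L0 M (F t) (S t)"
    using X unfolding sum_cone_def by blast
  show "(\<lambda>\<omega>. X \<omega> + Y \<omega>) \<in> sum_cone M F T S" if "Y \<in> sum_cone M F T S"
  proof -
    obtain \<upsilon> where \<upsilon>: "Y = (\<lambda>\<omega>. \<Sum>t\<le>T. \<upsilon> t \<omega>)" "\<And>t. t \<le> T \<Longrightarrow> \<upsilon> t \<in> L0 M (F t) (S t)"
      using \<open>Y \<in> sum_cone M F T S\<close> unfolding sum_cone_def by blast
    have "(\<lambda>\<omega>. \<zeta> t \<omega> + \<upsilon> t \<omega>) \<in> L0 M (F t) (S t)" if t: "t \<le> T" for t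
    proof -
      have "AE \<omega> in M. \<zeta> t \<omega> \<in> S t \<omega>" "AE \<omega> in M. \<upsilon> t \<omega> \<in> S t \<omega>"
        using \<zeta>(2)[OF t] \<upsilon>(2)[OF t] by (auto simp: L0_def)
      with cone[OF t] have "AE \<omega> in M. \<zeta> t \<omega> + \<upsilon> t \<omega> \<in> S t \<omega>"
        by eventually_elim (rule convex_cone_add)
      then show ?thesis using \<zeta>(2)[OF t] \<upsilon>(2)[OF t] by (auto simp: L0_def)
    qed
    moreover have "(\<lambda>\<omega>. X \<omega> + Y \<omega>) = (\<lambda>\<omega>. \<Sum>t\<le>T. \<zeta> t \<omega> + \<upsilon> t \<omega>)"
      by (simp add: \<zeta>(1) \<upsilon>(1) sum.distrib)
    ultimately show ?thesis
      unfolding sum_cone_def by (intro CollectI exI[of _ "\<lambda>t \<omega>. \<zeta> t \<omega> + \<upsilon> t \<omega>"] conjI allI impI)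
  qed
  show "(\<lambda>\<omega>. c *\<^sub>R X \<omega>) \<in> sum_cone M F T S" if c: "0 \<le> c"
  proof -
    have "(\<lambda>\<omega>. c *\<^sub>R \<zeta> t \<omega>) \<in> L0 M (F t) (S t)" if t: "t \<le> T" for t
    proof -
      have "AE \<omega> in M. \<zeta> t \<omega> \<in> S t \<omega>" using \<zeta>(2)[OF t] by (auto simp: L0_def)
      with cone[OF t] have "AE \<omega> in M. c *\<^sub>R \<zeta> t \<omega> \<in> S t \<omega>"
        by eventually_elim (rule convex_cone_scaleR[OF _ c])
      then show ?thesis using \<zeta>(2)[OF t] by (auto simp: L0_def)
    qed
    moreover have "(\<lambda>\<omega>. c *\<^sub>R X \<omega>) = (\<lambda>\<omega>. \<Sum>t\<le>T. c *\<^sub>R \<zeta> t \<omega>)"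
      by (simp add: \<zeta>(1) scaleR_sum_right)
    ultimately show ?thesis
      unfolding sum_cone_def by (intro CollectI exI[of _ "\<lambda>t \<omega>. c *\<^sub>R \<zeta> t \<omega>"] conjI allI impI)
  qed
qed

context filtered_claim_cone
begin

text \<open>At time \<open>T\<close> the process is \<open>W\<close> itself rather than a version of its conditional expectation.\<close>

definition dual_process :: "('a \<Rightarrow> real^'d) \<Rightarrow> nat \<Rightarrow> 'a \<Rightarrow> real^'d" where
  "dual_process W t = (if t = T then W else (\<lambda>\<omega>. \<chi> i. real_cond_exp M (F t) (\<lambda>\<omega>. W \<omega> $ i) \<omega>))"

lemma dual_process_T: "dual_process W T = W"
  by (simp add: dual_process_def)

lemma dual_integrable_component:
  assumes W: "W \<in> dual" shows "integrable M (\<lambda>\<omega>. W \<omega> $ i)"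
proof -
  have [measurable]: "W \<in> borel_measurable M" by (rule dual_measurable_M[OF W])
  obtain C where "AE \<omega> in M. norm (W \<omega>) \<le> C * \<phi> \<omega>" using dual_bounded[OF W] by blast
  then have "AE \<omega> in M. norm (W \<omega> $ i) \<le> \<bar>C\<bar>" using AE_space
  proof eventually_elim
    case (elim \<omega>)
    have "norm (W \<omega> $ i) \<le> norm (W \<omega>)" by (simp add: component_le_norm_cart)
    also have "\<dots> \<le> C * \<phi> \<omega>" by (rule elim)
    also have "\<dots> \<le> \<bar>C\<bar> * 1"
      using weight_pos[OF elim(2)] weight_le_1[OF elim(2)] by (intro mult_mono) auto
    finally show ?case by simp
  qed
  then show ?thesis by (intro integrable_const_bound[where B = "\<bar>C\<bar>"]) auto
qed

lemma dual_process_component: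
  assumes W: "W \<in> dual" and t: "t \<le> T"
  shows "AE \<omega> in M. real_cond_exp M (F t) (\<lambda>\<omega>. W \<omega> $ i) \<omega> = dual_process W t \<omega> $ i"
proof (cases "t = T")
  case True
  interpret sigma_finite_subalgebra M "F t" by (rule sigma_finite_subalgebraI[OF filtration[OF t]])
  have "(\<lambda>\<omega>. W \<omega> $ i) \<in> borel_measurable (F t)"
    unfolding True by (rule borel_measurable_component[OF dual_measurable[OF W]])
  from real_cond_exp_F_meas[OF dual_integrable_component[OF W] this]
  show ?thesis by (simp add: True dual_process_def)
qed (simp add: dual_process_def)

lemma dual_process_measurable:
  assumes W: "W \<in> dual" and t: "t \<le> T"
  shows "dual_process W t \<in> borel_measurable (F t)"
proof (cases "t = T")
  case True
  then show ?thesis using dual_measurable[OF W] by (simp add: dual_process_def)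
next
  case False
  interpret sigma_finite_subalgebra M "F t" by (rule sigma_finite_subalgebraI[OF filtration[OF t]])
  have "(\<lambda>\<omega>. (\<chi> i. real_cond_exp M (F t) (\<lambda>\<omega>. W \<omega> $ i) \<omega>) \<bullet> b) \<in> borel_measurable (F t)"
    if "b \<in> Basis" for b :: "real^'d"
  proof -
    have "(\<lambda>\<omega>. \<Sum>i\<in>UNIV. real_cond_exp M (F t) (\<lambda>\<omega>. W \<omega> $ i) \<omega> * b $ i) \<in> borel_measurable (F t)"
      by measurable
    then show ?thesis by (simp add: inner_vec_def)
  qed
  then have "(\<lambda>\<omega>. \<chi> i. real_cond_exp M (F t) (\<lambda>\<omega>. W \<omega> $ i) \<omega>) \<in> borel_measurable (F t)"
    by (rule borel_measurable_euclidean_space[THEN iffD2, OF ballI])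
  then show ?thesis using False by (simp add: dual_process_def)
qed

lemma martingale_dual_process:
  assumes W: "W \<in> dual" shows "martingale M F T (dual_process W)"
  unfolding martingale_def
proof (intro conjI allI impI)
  show "adapted F T (dual_process W)" using dual_process_measurable[OF W] by (simp add: adapted_def)
  have ic: "integrable M (\<lambda>\<omega>. dual_process W t \<omega> $ i)" if t: "t \<le> T" for t i
  proof -
    interpret sigma_finite_subalgebra M "F t" by (rule sigma_finite_subalgebraI[OF filtration[OF t]])
    have [measurable]: "dual_process W t \<in> borel_measurable M"
      by (rule measurable_F_M[OF t dual_process_measurable[OF W t]])
    show ?thesis
      by (rule integrable_cong_AE_imp[OF real_cond_exp_int(1)[OF dual_integrable_component[OF W, of i]]])
         (use dual_process_component[OF W t, of i] in \<open>auto elim: eventually_mono\<close>)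
  qed
  fix t assume t: "t \<le> T"
  have [measurable]: "dual_process W t \<in> borel_measurable M"
    by (rule measurable_F_M[OF t dual_process_measurable[OF W t]])
  show "integrable M (dual_process W t)"
  proof (rule Bochner_Integration.integrable_bound)
    show "integrable M (\<lambda>\<omega>. \<Sum>i\<in>UNIV. \<bar>dual_process W t \<omega> $ i\<bar>)"
      by (intro Bochner_Integration.integrable_sum integrable_abs ic t)
    show "AE \<omega> in M. norm (dual_process W t \<omega>) \<le> norm (\<Sum>i\<in>UNIV. \<bar>dual_process W t \<omega> $ i\<bar>)"
      by (intro AE_I2) (simp add: norm_le_l1_cart sum_nonneg)
  qed measurable
  fix s i assume s: "s \<le> t"
  then have sT: "s \<le> T" using t by simp
  interpret s: sigma_finite_subalgebra M "F s" by (rule sigma_finite_subalgebraI[OF filtration[OF sT]])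
  interpret t: sigma_finite_subalgebra M "F t" by (rule sigma_finite_subalgebraI[OF filtration[OF t]])
  have "AE \<omega> in M. real_cond_exp M (F s) (real_cond_exp M (F t) (\<lambda>\<omega>. W \<omega> $ i)) \<omega>
      = real_cond_exp M (F s) (\<lambda>\<omega>. dual_process W t \<omega> $ i) \<omega>"
    by (rule s.real_cond_exp_cong[OF dual_process_component[OF W t]]) measurable
  moreover have "AE \<omega> in M. real_cond_exp M (F s) (real_cond_exp M (F t) (\<lambda>\<omega>. W \<omega> $ i)) \<omega>
      = real_cond_exp M (F s) (\<lambda>\<omega>. W \<omega> $ i) \<omega>"
    by (rule s.real_cond_exp_nested_subalg[OF filtration[OF t] subalgebra_F[OF s t] dual_integrable_component[OF W]])
  moreover note dual_process_component[OF W sT, of i]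
  ultimately show "AE \<omega> in M. real_cond_exp M (F s) (\<lambda>\<omega>. dual_process W t \<omega> $ i) \<omega> = dual_process W s \<omega> $ i"
    by eventually_elim simp
qed

text \<open>Instead of a general measurable selection theorem, the projection of \<open>Z\<close> onto the random cone
  serves as the selection witnessing that \<open>Z\<close> lies outside the polar cone.\<close>

lemma martingale_in_polar:
  assumes Z: "martingale M F T Z" "Z T \<in> dual" and K: "trading_decomposition M F T A K" and t: "t \<le> T"
  shows "AE \<omega> in M. Z t \<omega> \<in> polar (K t \<omega>)"
proof -
  have cone: "closed (K s \<omega>)" "convex_cone (K s \<omega>)" if "s \<le> T" "\<omega> \<in> space M" for s \<omega>
    using K that space_F by (auto simp: trading_decomposition_def random_closed_cone_def)
  have AK: "A = sum_cone M F T K" using K by (simp add: trading_decomposition_def)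
  have ZF[measurable]: "Z t \<in> borel_measurable (F t)" by (rule martingale_measurable[OF Z(1) t])
  define P where "P \<omega> = closest_point (K t \<omega>) (Z t \<omega>)" for \<omega>
  have PF[measurable]: "P \<in> borel_measurable (F t)"
    unfolding P_def
  proof (rule borel_measurable_closest_point_random)
    show "{\<omega> \<in> space (F t). K t \<omega> \<inter> U \<noteq> {}} \<in> sets (F t)" if "open U" for U
      using K t that by (auto simp: trading_decomposition_def random_closed_cone_def)
    show "closed (K t \<omega>) \<and> convex (K t \<omega>) \<and> K t \<omega> \<noteq> {}" if "\<omega> \<in> space (F t)" for \<omega>
      using cone[OF t, of \<omega>] that space_F[OF t] by (auto simp: convex_cone_def)
  qed (rule ZF)
  have P: "P \<omega> \<in> K t \<omega>" "Z t \<omega> \<bullet> P \<omega> = P \<omega> \<bullet> P \<omega>" "P \<omega> = 0 \<Longrightarrow> x \<in> K t \<omega> \<Longrightarrow> Z t \<omega> \<bullet> x \<le> 0"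
    if "\<omega> \<in> space M" for \<omega> x
    unfolding P_def using closest_point_convex_cone[OF cone[OF t that]] by blast+
  \<comment> \<open>\<open>P\<close> may fail to be integrable, so it is truncated at norm
    \<open>n\<close>; as zero lies in the cone, the truncation \<open>H\<close> is still a trade.
    Its pairing with \<open>Z t\<close> equals \<open>H \<omega> \<bullet> H \<omega>\<close>, while
    polarity makes the mean non-positive, so \<open>H\<close> vanishes.\<close>
  have "AE \<omega> in M. norm (P \<omega>) \<le> real n \<longrightarrow> P \<omega> = 0" for n
  proof -
    define H where "H \<omega> = (if norm (P \<omega>) \<le> real n then P \<omega> else 0)" for \<omega>
    have HF: "H \<in> borel_measurable (F t)" unfolding H_def by measurable
    have H1: "H \<in> L1w"
      by (rule bounded_imp_L1w[OF measurable_F_mono[OF t order_refl HF], where B = "real n"]) (simp add: H_def)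
    have HK: "H \<in> L0 M (F t) (K t)"
      using HF P(1) convex_cone_contains_0[OF cone(2)[OF t]] by (auto simp: L0_def H_def)
    have "H \<in> A"
      unfolding AK by (rule sum_cone_single[where F = F and S = K, OF t HK]) (use convex_cone_contains_0[OF cone(2)] in auto)
    then have "(\<integral>\<omega>. H \<omega> \<bullet> Z T \<omega> \<partial>M) \<le> 0"
      using dual_inner_le[OF Z(2) _ H1] by (simp add: inner_commute)
    then have le: "(\<integral>\<omega>. H \<omega> \<bullet> Z t \<omega> \<partial>M) \<le> 0"
      using martingale_inner_terminal(3)[OF Z t HF H1] by simp
    have HH: "H \<omega> \<bullet> Z t \<omega> = H \<omega> \<bullet> H \<omega>" if "\<omega> \<in> space M" for \<omega>
      using P(2)[OF that] by (simp add: H_def inner_commute)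
    have nn: "AE \<omega> in M. 0 \<le> H \<omega> \<bullet> Z t \<omega>" using HH by (intro AE_I2) simp
    have "(\<integral>\<omega>. H \<omega> \<bullet> Z t \<omega> \<partial>M) = 0" using le integral_nonneg_AE[OF nn] by linarith
    then have "AE \<omega> in M. H \<omega> \<bullet> Z t \<omega> = 0"
      using integral_nonneg_eq_0_iff_AE[OF martingale_inner_terminal(1)[OF Z t HF H1] nn] by blast
    then show ?thesis using AE_space
      by eventually_elim (use HH in \<open>auto simp: H_def\<close>)
  qed
  then have "AE \<omega> in M. \<forall>n. norm (P \<omega>) \<le> real n \<longrightarrow> P \<omega> = 0" by (rule AE_all_countable[THEN iffD2, OF allI])
  then show ?thesis using AE_space
  proof eventually_elim
    case (elim \<omega>)
    then have "P \<omega> = 0" using real_arch_simple by blast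
    then show ?case using P(3)[OF elim(2)] by (simp add: polar_def)
  qed
qed

text \<open>Conditional expectation keeps a strictly positive variable strictly positive, so the
  \<open>i\<close>-th coordinate prevents the process from vanishing at any time.\<close>

lemma dual_process_consistent:
  assumes W: "W \<in> dual" "AE \<omega> in M. 0 < W \<omega> $ i" and K: "trading_decomposition M F T A K"
  shows "dual_process W \<in> consistent_polar M F T \<phi> (\<lambda>\<omega>. 1 / \<phi> \<omega>) A K"
proof -
  have mart: "martingale M F T (dual_process W)" by (rule martingale_dual_process[OF W(1)])
  have "AE \<omega> in M. dual_process W t \<omega> \<in> polar (K t \<omega>) - {0}" if t: "t \<le> T" for t
  proof -
    interpret sigma_finite_subalgebra M "F t" by (rule sigma_finite_subalgebraI[OF filtration[OF t]])
    have "AE \<omega> in M. dual_process W t \<omega> \<in> polar (K t \<omega>)"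
      by (rule martingale_in_polar[OF mart _ K t]) (simp add: dual_process_T W)
    moreover have "AE \<omega> in M. 0 < real_cond_exp M (F t) (\<lambda>\<omega>. W \<omega> $ i) \<omega>"
      by (rule real_cond_exp_gr_c[OF dual_integrable_component[OF W(1)] W(2)])
    moreover note dual_process_component[OF W(1) t, of i]
    ultimately show ?thesis by eventually_elim auto
  qed
  then show ?thesis
    using mart W(1) by (simp add: consistent_polar_def consistent_price_process_def dual_process_T)
qed

text \<open>The forward direction is polarity. Conversely, \<open>bipolar\<close> demands a test
  against every dual element, while the hypothesis speaks only of those that generate nonvanishing
  processes; the perturbation by \<open>Z0\<close> bridges this.\<close>

lemma trade_cone_iff_consistent:
  assumes K: "trading_decomposition M F T A K" and t: "t \<le> T"
    and H: "H \<in> borel_measurable (F t)" "H \<in> L1w"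
  shows "H \<in> trade_cone F A t \<longleftrightarrow>
    (\<forall>Z\<in>consistent_polar M F T \<phi> (\<lambda>\<omega>. 1 / \<phi> \<omega>) A K. AE \<omega> in M. H \<omega> \<bullet> Z t \<omega> \<le> 0)"
proof
  assume HC: "H \<in> trade_cone F A t"
  show "\<forall>Z\<in>consistent_polar M F T \<phi> (\<lambda>\<omega>. 1 / \<phi> \<omega>) A K. AE \<omega> in M. H \<omega> \<bullet> Z t \<omega> \<le> 0"
  proof
    fix Z assume "Z \<in> consistent_polar M F T \<phi> (\<lambda>\<omega>. 1 / \<phi> \<omega>) A K"
    then have Z: "martingale M F T Z" "Z T \<in> dual"
      by (auto simp: consistent_polar_def consistent_price_process_def)
    show "AE \<omega> in M. H \<omega> \<bullet> Z t \<omega> \<le> 0"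
      unfolding martingale_inner_nonpos_iff[OF Z t H]
    proof
      fix c assume c: "c \<in> bounded_nonneg (F t)"
      then have "(\<lambda>\<omega>. c \<omega> *\<^sub>R H \<omega>) \<in> A" using HC by (simp add: trade_cone_def)
      then show "(\<integral>\<omega>. Z T \<omega> \<bullet> (c \<omega> *\<^sub>R H \<omega>) \<partial>M) \<le> 0"
        by (rule dual_inner_le[OF Z(2) _ L1w_scaleR_bounded(2)[OF t H c]])
    qed
  qed
next
  assume le: "\<forall>Z\<in>consistent_polar M F T \<phi> (\<lambda>\<omega>. 1 / \<phi> \<omega>) A K. AE \<omega> in M. H \<omega> \<bullet> Z t \<omega> \<le> 0"
  obtain i :: 'd where True by simp
  obtain Z0 where Z0: "Z0 \<in> dual" "AE \<omega> in M. 0 < Z0 \<omega> $ i" by (rule strictly_positive_dual)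
  have "(\<lambda>\<omega>. c \<omega> *\<^sub>R H \<omega>) \<in> A" if c: "c \<in> bounded_nonneg (F t)" for c
  proof (rule bipolar)
    show cH: "(\<lambda>\<omega>. c \<omega> *\<^sub>R H \<omega>) \<in> L1w" by (rule L1w_scaleR_bounded(2)[OF t H c])
    fix Y assume Y: "Y \<in> dual"
    \<comment> \<open>The pairing of the perturbed density is the affine function
      \<open>y + e * z\<close> of \<open>e\<close>, so its value at zero, the pairing with
      \<open>Y\<close>, is reached as a limit.\<close>
    define y z where "y = (\<integral>\<omega>. Y \<omega> \<bullet> (c \<omega> *\<^sub>R H \<omega>) \<partial>M)" and "z = (\<integral>\<omega>. Z0 \<omega> \<bullet> (c \<omega> *\<^sub>R H \<omega>) \<partial>M)"
    have le0: "y + e * z \<le> 0" if e: "0 < e" for e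
    proof -
      define W where "W \<omega> = Y \<omega> + e *\<^sub>R Z0 \<omega>" for \<omega>
      have W: "W \<in> dual"
        unfolding W_def by (intro dual_add dual_scaleR Y Z0) (use e in simp)
      have "AE \<omega> in M. 0 < W \<omega> $ i"
        using Z0(2) dual_nonneg[OF Y]
        by eventually_elim (simp add: W_def e add_nonneg_pos)
      then have "dual_process W \<in> consistent_polar M F T \<phi> (\<lambda>\<omega>. 1 / \<phi> \<omega>) A K"
        by (rule dual_process_consistent[OF W _ K])
      then have "AE \<omega> in M. H \<omega> \<bullet> dual_process W t \<omega> \<le> 0" using le by blast
      then have "(\<integral>\<omega>. W \<omega> \<bullet> (c \<omega> *\<^sub>R H \<omega>) \<partial>M) \<le> 0"
        using martingale_inner_nonpos_iff[OF martingale_dual_process[OF W] _ t H] W c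
        by (simp add: dual_process_T)
      moreover have "(\<integral>\<omega>. W \<omega> \<bullet> (c \<omega> *\<^sub>R H \<omega>) \<partial>M) = y + e * z"
      proof -
        have "integrable M (\<lambda>\<omega>. e * (Z0 \<omega> \<bullet> (c \<omega> *\<^sub>R H \<omega>)))"
          by (intro integrable_mult_right integrable_inner[OF Z0(1) cH])
        from Bochner_Integration.integral_add[OF integrable_inner[OF Y cH] this]
        show ?thesis
          unfolding W_def y_def z_def inner_add_left inner_scaleR_left integral_mult_right_zero .
      qed
      ultimately show ?thesis by simp
    qed
    have le: "y + (1 / real (Suc n)) * z \<le> 0" for n by (rule le0) simp
    have "(\<lambda>n. y + (1 / real (Suc n)) * z) \<longlonglongrightarrow> y + 0 * z"
      by (intro tendsto_intros LIMSEQ_Suc[OF lim_inverse_n'])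
    then have "y + 0 * z \<le> 0" by (rule LIMSEQ_le_const2) (intro exI[of _ 0] allI impI le)
    then show "(\<integral>\<omega>. Y \<omega> \<bullet> (c \<omega> *\<^sub>R H \<omega>) \<partial>M) \<le> 0" by (simp add: y_def)
  qed
  then show "H \<in> trade_cone F A t" using H(1) by (simp add: trade_cone_def)
qed

end

theorem theorem4p16:
  fixes M :: "'a measure" and F :: "nat \<Rightarrow> 'a measure" and T :: nat
    and p :: "nat \<Rightarrow> 'a \<Rightarrow> real^'d^'d"
    and A :: "('a \<Rightarrow> real^'d) set"
    and K :: "nat \<Rightarrow> 'a \<Rightarrow> (real^'d) set"
    and \<phi> \<psi> :: "'a \<Rightarrow> real"
    and \<theta> :: "'a \<Rightarrow> real^'d"
    and \<eta> \<xi> :: "nat \<Rightarrow> 'a \<Rightarrow> real^'d"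
  assumes "filtered_prob_space M F T"
    and "bid_ask_process M F T p"
    and "A = attainable M F T p"
    and "closed_in_prob M (F T) A" and "arbitrage_free M A"
    and "trading_decomposition M F T A K"
    and "\<phi> \<in> borel_measurable (F T)" and "\<forall>\<omega>\<in>space M. 0 < \<phi> \<omega> \<and> \<phi> \<omega> \<le> 1"
    and "\<psi> = (\<lambda>\<omega>. 1 / \<phi> \<omega>)"
    and "\<theta> \<in> A \<inter> L1_weighted M (F T) \<phi>"
    and "adapted F T \<eta>" and "\<forall>t\<le>T. \<eta> t \<in> L1_weighted M (F T) \<phi>"
    and "AE \<omega> in M. \<eta> T \<omega> = \<theta> \<omega>"
    and "\<xi> = (\<lambda>t \<omega>. \<eta> t \<omega> - lag \<eta> t \<omega>)"
  shows "\<xi> \<in> Pi {0..T} (\<lambda>t. trade_cone F A t \<inter> L1_weighted M (F T) \<phi>) \<longleftrightarrow>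
    (\<forall>Z \<in> consistent_polar M F T \<phi> \<psi> A K.
       supermartingale M F T (\<lambda>t \<omega>. lag \<eta> t \<omega> \<bullet> Z t \<omega>) \<and>
       (AE \<omega> in M. lag \<eta> T \<omega> \<bullet> Z T \<omega> \<ge> \<theta> \<omega> \<bullet> Z T \<omega>))"
proof -
  have sub: "subalgebra M (F t)" if "t \<le> T" for t
    using assms(1) that by (simp add: filtered_prob_space_def)
  have mono: "sets (F s) \<subseteq> sets (F t)" if "s \<le> t" "t \<le> T" for s t
    using assms(1) that by (simp add: filtered_prob_space_def)
  interpret prob_space M using assms(1) by (simp add: filtered_prob_space_def)
  have AK: "A = sum_cone M F T K" using assms(6) by (simp add: trading_decomposition_def)
  have Kcone: "AE \<omega> in M. convex_cone (K t \<omega>)" if "t \<le> T" for t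
    using assms(6) that sub[OF that]
    by (intro AE_I2) (simp add: trading_decomposition_def random_closed_cone_def subalgebra_def)
  \<comment> \<open>The generators of the solvency cone enter here: a non-positive claim is a trade
    at time \<open>T\<close> alone. Measurability and the cone operations are read off the
    decomposition \<open>K\<close>.\<close>
  have nonpos: "X \<in> A" if "X \<in> borel_measurable (F T)" "\<And>\<omega> i. X \<omega> $ i \<le> 0" for X
    unfolding assms(3) attainable_def
  proof (rule sum_cone_single[where t = T])
    show "X \<in> L0 M (F T) (\<lambda>\<omega>. uminus ` solvency_cone (p T \<omega>))"
      unfolding L0_def by (intro CollectI conjI AE_I2 nonpos_mem_neg_solvency_cone that)
    show "AE \<omega> in M. 0 \<in> uminus ` solvency_cone (p s \<omega>)" for s
      by (intro AE_I2 nonpos_mem_neg_solvency_cone) simp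
  qed simp
  have AF: "A \<subseteq> borel_measurable (F T)"
  proof
    fix X assume "X \<in> A"
    then obtain \<zeta> where X: "X = (\<lambda>\<omega>. \<Sum>t\<le>T. \<zeta> t \<omega>)" and \<zeta>: "\<And>t. t \<le> T \<Longrightarrow> \<zeta> t \<in> L0 M (F t) (K t)"
      unfolding AK sum_cone_def by blast
    have "\<zeta> t \<in> borel_measurable (F T)" if "t \<le> T" for t
    proof (rule measurable_from_subalg)
      show "subalgebra (F T) (F t)"
        using sub[OF that] sub[of T] mono[OF that] by (simp add: subalgebra_def)
      show "\<zeta> t \<in> borel_measurable (F t)" using \<zeta>[OF that] by (simp add: L0_def)
    qed
    then show "X \<in> borel_measurable (F T)" unfolding X by (intro borel_measurable_sum) simp
  qed
  interpret filtered_claim_cone M F T \<phi> A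
  proof unfold_locales
    show "(\<lambda>\<omega>. X \<omega> + Y \<omega>) \<in> A" if "X \<in> A" "Y \<in> A" for X Y
      using that unfolding AK by (intro sum_cone_add_scaleR(1)[OF Kcone])
    show "(\<lambda>\<omega>. c *\<^sub>R X \<omega>) \<in> A" if "X \<in> A" "0 \<le> c" for X c
      using that unfolding AK by (intro sum_cone_add_scaleR(2)[OF Kcone])
  qed (use assms sub mono nonpos AF in auto)
  have \<xi>F: "\<xi> t \<in> borel_measurable (F t)" and \<xi>1: "\<xi> t \<in> L1w" if "t \<le> T" for t
    using assms(11,12) that lag_measurable[OF assms(11) that] L1w_diff[OF _ lag_L1w[OF assms(12) that]]
    by (auto simp: assms(14) adapted_def)
  have "\<xi> \<in> Pi {0..T} (\<lambda>t. trade_cone F A t \<inter> L1w) \<longleftrightarrow>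
      (\<forall>Z\<in>consistent_polar M F T \<phi> \<psi> A K. \<forall>t\<le>T. AE \<omega> in M. \<xi> t \<omega> \<bullet> Z t \<omega> \<le> 0)"
    using trade_cone_iff_consistent[OF assms(6) _ \<xi>F \<xi>1] \<xi>1 by (auto simp: Pi_iff assms(9))
  also have "\<dots> \<longleftrightarrow> (\<forall>Z \<in> consistent_polar M F T \<phi> \<psi> A K.
       supermartingale M F T (\<lambda>t \<omega>. lag \<eta> t \<omega> \<bullet> Z t \<omega>) \<and>
       (AE \<omega> in M. lag \<eta> T \<omega> \<bullet> Z T \<omega> \<ge> \<theta> \<omega> \<bullet> Z T \<omega>))"
  \<comment> \<open>After exchanging the quantifiers over times and processes, the equivalence can
    be proved for one process at a time.\<close>
  proof (rule ball_cong[OF refl])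
    fix Z assume "Z \<in> consistent_polar M F T \<phi> \<psi> A K"
    then have Z: "martingale M F T Z" "Z T \<in> dual"
      by (auto simp: consistent_polar_def consistent_price_process_def assms(9))
    show "(\<forall>t\<le>T. AE \<omega> in M. \<xi> t \<omega> \<bullet> Z t \<omega> \<le> 0) \<longleftrightarrow>
       supermartingale M F T (\<lambda>t \<omega>. lag \<eta> t \<omega> \<bullet> Z t \<omega>) \<and>
       (AE \<omega> in M. lag \<eta> T \<omega> \<bullet> Z T \<omega> \<ge> \<theta> \<omega> \<bullet> Z T \<omega>)"
      using supermartingale_lag_iff[OF Z assms(11,12,13)] by (simp add: assms(14))
  qed
  finally show ?thesis .
qed

end
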